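(* Let $R$ be a normed ring that respects the rationals, let $n\ge 0$ be an integer, and let $G$ and $H$ be quasi-isometric groups, both $(n+1)$-dimensional admissible over $R$. Assume that their homological $n$-isoperimetric functions over $R$, $f_n^G$ and $f_n^H$, take only finite values. Then $f_n^G$ and $f_n^H$ define the same (growth rate) class.
   Context: All modules are left modules; groups are discrete and $RG$ denotes the group ring. Quasi-isometry of groups refers to finitely generated groups with word metrics. Normed rings. A normed ring is a (unital, associative) ring $R$ with a norm $|\cdot|\colon R\to\mathbb{R}_{\ge 0}$, i.e. $|a|=0$ iff $a=0$, $|a+b|\le |a|+|b|$, $|-a|=|a|$, $|ab|\le |a||b|$. It respects the rationals if $\mathbb{Q}$ is a subring of $R$ and $|qr|=|q||r|$ for all $q\in\mathbb{Q}$, $r\in R$, where $|q|$ on the right denotes the usual absolute value of the rational number $q$. $\ell^1$-norms. On a free $R$-module with fixed basis $\Lambda$ the $\ell^1$-norm is $\left|\sum_{x\in\Lambda}a_x x\right|=\sum_{x\in\Lambda}|a_x|$. A free $RG$-module with fixed $RG$-basis $\Lambda$ is regarded as a free $R$-module with basis $\Lambda\times G$ and given the corresponding $\ell^1$-norm. For a $G$-set $S$, the permutation $RG$-module $R[S]$ is the free $R$-module on $S$ with $G$-action extending $R$-linearly the action on $S$; its standard $\ell^1$-norm is the one given by the $R$-basis $S$. It is a proper permutation module if the $G$-stabilizer of each $s\in S$ is finite. Isoperimetric function. A projective resolution $(C_k,\partial_k)$ of the trivial $RG$-module $R$ is $n$-admissible if $C_n$ and $C_{n+1}$ are finitely generated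 free $RG$-modules equipped with fixed free bases. On $\operatorname{Im}(\partial_{n+1})\subseteq C_n$ consider the filling norm $\|b\|=\inf\{|c| : c\in C_{n+1},\ \partial_{n+1}(c)=b\}$. The $n$-isoperimetric function of the resolution is $$f_n(l)=\sup\{\|b\| : b\in \operatorname{Im}(\partial_{n+1}),\ |b|\le l\}\in\mathbb{R}_{\ge 0}\cup\{\infty\},\qquad l\in \mathbb{R}_{\ge 0}.$$ The homological $n$-isoperimetric function $f_n^G$ of $G$ over $R$ is the $n$-isoperimetric function of an $n$-admissible projective resolution of the trivial $RG$-module $R$; it takes only finite values if $f_n^G(l)<\infty$ for every $l\in\mathbb{R}_{\ge 0}$ (independent of the chosen resolution). Admissible groups. $G$ is $(n+1)$-dimensional admissible over $R$ if there exists a projective resolution $(C_k,\partial_k)$ of the trivial $RG$-module $R$ such that $C_n$ and $C_{n+1}$ are finitely generated proper permutation $RG$-modules endowed with standard $\ell^1$-norms and $\partial_{n+1}\colon C_{n+1}\to C_n$ is injective. Growth rate classes. For functions $f,g\colon\mathbb{R}_{\ge 0}\to\mathbb{R}_{\ge 0}$ write $f\preceq g$ if there is a constant $C>0$ with $f(l)\le C\,g(Cl+C)+Cl+C$ for all $l\ge 0$. The functions $f,g$ define the same growth rate class if $f\preceq g$ and $g\preceq f$. *)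

theory Defs
  imports
    Complex_Main
    "HOL-Library.Poly_Mapping"
    "HOL-Library.Extended_Nonnegative_Real"
begin

text \<open>
  Groups are types of class \<^class>\<open>group_add\<close>; despite the additive notation this class does not
  assume commutativity. The group ring \<open>RG\<close> is the type \<open>'g \<Rightarrow>\<^sub>0 'r\<close> of finitely supported functions,
  whose library multiplication is the convolution product.
\<close>

section \<open>Normed rings\<close>

locale normed_unital_ring =
  fixes nrm :: "'r::ring_1 \<Rightarrow> real"
  assumes nrm_nonneg: "0 \<le> nrm a"
    and nrm_eq_0_iff: "nrm a = 0 \<longleftrightarrow> a = 0"
    and nrm_add: "nrm (a + b) \<le> nrm a + nrm b"
    and nrm_minus: "nrm (- a) = nrm a"
    and nrm_mult: "nrm (a * b) \<le> nrm a * nrm b"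

locale rational_normed_ring = normed_unital_ring nrm for nrm :: "'r::ring_1 \<Rightarrow> real" +
  assumes rationals:
    "\<exists>\<iota> :: rat \<Rightarrow> 'r. inj \<iota> \<and> \<iota> 1 = 1 \<and> (\<forall>p q. \<iota> (p + q) = \<iota> p + \<iota> q) \<and>
       (\<forall>p q. \<iota> (p * q) = \<iota> p * \<iota> q) \<and> (\<forall>q r. nrm (\<iota> q * r) = \<bar>real_of_rat q\<bar> * nrm r)"

section \<open>Left modules over a not necessarily commutative ring\<close>

text \<open>
  The library's module locales require a commutative ring of scalars. A module is a subset of an
  ambient type carrying a scalar multiplication. Countably many modules (the terms of a resolution)
  can always be realised as submodules of one ambient module, namely their direct sum.
\<close>

locale left_module =
  fixes scale :: "'s::ring_1 \<Rightarrow> 'm::ab_group_add \<Rightarrow> 'm"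
  assumes scale_add_right: "scale a (x + y) = scale a x + scale a y"
    and scale_add_left: "scale (a + b) x = scale a x + scale b x"
    and scale_scale: "scale a (scale b x) = scale (a * b) x"
    and scale_one: "scale 1 x = x"

definition submodule :: "('s::ring_1 \<Rightarrow> 'm::ab_group_add \<Rightarrow> 'm) \<Rightarrow> 'm set \<Rightarrow> bool" where
  "submodule scale M \<longleftrightarrow>
     0 \<in> M \<and> (\<forall>x\<in>M. \<forall>y\<in>M. x + y \<in> M) \<and> (\<forall>a. \<forall>x\<in>M. scale a x \<in> M)"

definition module_hom_on ::
  "('s::ring_1 \<Rightarrow> 'm::ab_group_add \<Rightarrow> 'm) \<Rightarrow> ('s \<Rightarrow> 'n::ab_group_add \<Rightarrow> 'n) \<Rightarrow>
   'm set \<Rightarrow> 'n set \<Rightarrow> ('m \<Rightarrow> 'n) \<Rightarrow> bool" where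
  "module_hom_on s t M N f \<longleftrightarrow>
     f ` M \<subseteq> N \<and> (\<forall>x\<in>M. \<forall>y\<in>M. f (x + y) = f x + f y) \<and> (\<forall>a. \<forall>x\<in>M. f (s a x) = t a (f x))"

definition lincomb ::
  "('s::ring_1 \<Rightarrow> 'm::ab_group_add \<Rightarrow> 'm) \<Rightarrow> ('b \<Rightarrow> 'm) \<Rightarrow> ('b \<Rightarrow>\<^sub>0 's) \<Rightarrow> 'm" where
  "lincomb scale v \<phi> = (\<Sum>b\<in>Poly_Mapping.keys \<phi>. scale (Poly_Mapping.lookup \<phi> b) (v b))"

definition module_basis ::
  "('s::ring_1 \<Rightarrow> 'm::ab_group_add \<Rightarrow> 'm) \<Rightarrow> 'm set \<Rightarrow> 'm set \<Rightarrow> bool" where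
  "module_basis scale M B \<longleftrightarrow> B \<subseteq> M \<and>
     (\<forall>x\<in>M. \<exists>!\<phi> :: 'm \<Rightarrow>\<^sub>0 's. Poly_Mapping.keys \<phi> \<subseteq> B \<and> x = lincomb scale (\<lambda>b. b) \<phi>)"

definition coords ::
  "('s::ring_1 \<Rightarrow> 'm::ab_group_add \<Rightarrow> 'm) \<Rightarrow> 'm set \<Rightarrow> 'm \<Rightarrow> ('m \<Rightarrow>\<^sub>0 's)" where
  "coords scale B x = (THE \<phi>. Poly_Mapping.keys \<phi> \<subseteq> B \<and> x = lincomb scale (\<lambda>b. b) \<phi>)"

definition finitely_generated ::
  "('s::ring_1 \<Rightarrow> 'm::ab_group_add \<Rightarrow> 'm) \<Rightarrow> 'm set \<Rightarrow> bool" where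
  "finitely_generated scale M \<longleftrightarrow>
     (\<exists>X. finite X \<and> X \<subseteq> M \<and> (\<forall>y\<in>M. \<exists>c. y = (\<Sum>x\<in>X. scale (c x) x)))"

definition free_scale :: "'s::ring_1 \<Rightarrow> ('b \<Rightarrow>\<^sub>0 's) \<Rightarrow> ('b \<Rightarrow>\<^sub>0 's)" where
  "free_scale a = Poly_Mapping.map ((*) a)"

text \<open>
  Projective means: isomorphic to a direct summand of a free module, i.e. a retract of one. Since
  a projective module is a retract of the free module on its own underlying set, it suffices to
  consider the free module on the ambient type. The two lemmas below show that this is equivalent
  to the lifting property, with respect to modules in arbitrary types.
\<close>

definition projective_module ::
  "('s::ring_1 \<Rightarrow> 'm::ab_group_add \<Rightarrow> 'm) \<Rightarrow> 'm set \<Rightarrow> bool" where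
  "projective_module scale P \<longleftrightarrow>
     (\<exists>(i :: 'm \<Rightarrow> ('m \<Rightarrow>\<^sub>0 's)) q.
        module_hom_on scale free_scale P UNIV i \<and>
        module_hom_on free_scale scale UNIV P q \<and>
        (\<forall>x\<in>P. q (i x) = x))"

lemma lookup_free_scale: "Poly_Mapping.lookup (free_scale a \<phi>) b = a * Poly_Mapping.lookup \<phi> b"
  by (simp add: free_scale_def Poly_Mapping.map.rep_eq when_def)

lemma left_module_free_scale: "left_module free_scale"
  by unfold_locales
    (auto intro!: poly_mapping_eqI simp: lookup_free_scale lookup_add algebra_simps)

context left_module
begin

lemma scale_zero_left: "scale 0 x = 0"
  using scale_add_left[of 0 0 x] by simp

lemma scale_zero_right: "scale a 0 = 0"
  using scale_add_right[of a 0 0] by simp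

lemma scale_sum_right: "scale a (sum f A) = (\<Sum>x\<in>A. scale a (f x))"
  by (induction A rule: infinite_finite_induct) (auto simp: scale_zero_right scale_add_right)

lemma lincomb_superset:
  assumes "finite A" "Poly_Mapping.keys \<phi> \<subseteq> A"
  shows "lincomb scale v \<phi> = (\<Sum>b\<in>A. scale (Poly_Mapping.lookup \<phi> b) (v b))"
  unfolding lincomb_def using assms
  by (intro sum.mono_neutral_left) (auto simp: scale_zero_left in_keys_iff)

lemma lincomb_add: "lincomb scale v (\<phi> + \<psi>) = lincomb scale v \<phi> + lincomb scale v \<psi>"
proof -
  let ?A = "Poly_Mapping.keys \<phi> \<union> Poly_Mapping.keys \<psi>"
  have "Poly_Mapping.keys (\<phi> + \<psi>) \<subseteq> ?A"
    by (rule Poly_Mapping.keys_add)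
  then show ?thesis
    by (simp add: lincomb_superset[of ?A] lookup_add scale_add_left sum.distrib)
qed

lemma lincomb_free_scale: "lincomb scale v (free_scale a \<phi>) = scale a (lincomb scale v \<phi>)"
proof -
  have "Poly_Mapping.keys (free_scale a \<phi>) \<subseteq> Poly_Mapping.keys \<phi>"
    by (auto simp: in_keys_iff lookup_free_scale)
  then show ?thesis
    by (simp add: lincomb_superset[of "Poly_Mapping.keys \<phi>"] lookup_free_scale scale_scale
        scale_sum_right)
qed

lemma lincomb_single: "lincomb scale v (Poly_Mapping.single b 1) = v b"
  by (simp add: lincomb_def scale_one)

lemma lincomb_in:
  assumes "submodule scale M" "\<And>b. v b \<in> M"
  shows "lincomb scale v \<phi> \<in> M"
proof -
  have "(\<Sum>b\<in>A. scale (Poly_Mapping.lookup \<phi> b) (v b)) \<in> M" for A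
    using assms by (induction A rule: infinite_finite_induct) (auto simp: submodule_def)
  then show ?thesis by (simp add: lincomb_def)
qed

lemma module_hom_lincomb:
  assumes "submodule scale M" "\<And>b. v b \<in> M"
  shows "module_hom_on free_scale scale UNIV M (lincomb scale v)"
  using lincomb_in[OF assms] by (auto simp: module_hom_on_def lincomb_add lincomb_free_scale)

end

lemma module_hom_on_free:
  assumes t: "left_module t" and f: "module_hom_on free_scale t UNIV N f"
  shows "f \<phi> = lincomb t (\<lambda>b. f (Poly_Mapping.single b 1)) \<phi>"
proof -
  have f0: "f 0 = 0"
    using f unfolding module_hom_on_def by (metis UNIV_I add_cancel_left_left)
  have *: "(\<Sum>b\<in>A. t (Poly_Mapping.lookup \<phi> b) (f (Poly_Mapping.single b 1))) =
    f (\<Sum>b\<in>A. free_scale (Poly_Mapping.lookup \<phi> b) (Poly_Mapping.single b 1))" for A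
    using f f0 by (induction A rule: infinite_finite_induct) (auto simp: module_hom_on_def)
  have "(\<Sum>b\<in>Poly_Mapping.keys \<phi>. free_scale (Poly_Mapping.lookup \<phi> b) (Poly_Mapping.single b 1)) = \<phi>"
    by (rule poly_mapping_eqI)
      (simp add: lookup_sum lookup_free_scale lookup_single when_def in_keys_iff if_distrib
        sum.If_cases cong: if_cong)
  then show ?thesis
    using *[of "Poly_Mapping.keys \<phi>"] by (simp add: lincomb_def)
qed

lemma projective_module_lifting:
  fixes s :: "'s::ring_1 \<Rightarrow> 'm::ab_group_add \<Rightarrow> 'm"
    and t :: "'s \<Rightarrow> 'a::ab_group_add \<Rightarrow> 'a" and u :: "'s \<Rightarrow> 'b::ab_group_add \<Rightarrow> 'b"
  assumes "left_module t" "left_module u"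
    and P: "projective_module s P"
    and M: "submodule t M"
    and f: "module_hom_on s u P N f" and p: "module_hom_on t u M N p" and surj: "p ` M = N"
  shows "\<exists>h. module_hom_on s t P M h \<and> (\<forall>x\<in>P. p (h x) = f x)"
proof -
  interpret t: left_module t by fact
  from P obtain i :: "'m \<Rightarrow> ('m \<Rightarrow>\<^sub>0 's)" and q where i: "module_hom_on s free_scale P UNIV i"
    and q: "module_hom_on free_scale s UNIV P q" and iq: "\<And>x. x \<in> P \<Longrightarrow> q (i x) = x"
    unfolding projective_module_def by blast
  have "\<exists>m. m \<in> M \<and> p m = f (q (Poly_Mapping.single b 1))" for b
  proof -
    have "f (q (Poly_Mapping.single b 1)) \<in> p ` M"
      using f q surj by (auto simp: module_hom_on_def image_subset_iff)
    then show ?thesis by auto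
  qed
  then obtain v where vM: "\<And>b. v b \<in> M" and v: "\<And>b. p (v b) = f (q (Poly_Mapping.single b 1))"
    by metis
  have L: "module_hom_on free_scale t UNIV M (lincomb t v)"
    by (rule t.module_hom_lincomb) (use M vM in auto)
  have pL: "module_hom_on free_scale u UNIV N (\<lambda>\<phi>. p (lincomb t v \<phi>))"
    using p L by (auto simp: module_hom_on_def image_subset_iff)
  have fq: "module_hom_on free_scale u UNIV N (\<lambda>\<phi>. f (q \<phi>))"
    using f q by (auto simp: module_hom_on_def image_subset_iff)
  have eq: "p (lincomb t v \<phi>) = f (q \<phi>)" for \<phi>
    by (subst module_hom_on_free[OF assms(2) pL], subst module_hom_on_free[OF assms(2) fq])
      (simp add: t.lincomb_single v)
  have "module_hom_on s t P M (\<lambda>x. lincomb t v (i x))"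
    using L i by (auto simp: module_hom_on_def image_subset_iff)
  moreover have "\<forall>x\<in>P. p (lincomb t v (i x)) = f x"
    by (simp add: eq iq)
  ultimately show ?thesis by blast
qed

lemma projective_moduleI_section:
  assumes "left_module (s :: 's::ring_1 \<Rightarrow> 'm::ab_group_add \<Rightarrow> 'm)" and P: "submodule s P"
    and sec: "\<And>q :: ('m \<Rightarrow>\<^sub>0 's) \<Rightarrow> 'm. module_hom_on free_scale s UNIV P q \<Longrightarrow> q ` UNIV = P \<Longrightarrow>
       \<exists>h. module_hom_on s free_scale P UNIV h \<and> (\<forall>x\<in>P. q (h x) = x)"
  shows "projective_module s P"
proof -
  interpret left_module s by fact
  let ?v = "\<lambda>b. if b \<in> P then b else 0"
  have vP: "?v b \<in> P" for b using P by (auto simp: submodule_def)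
  have hom: "module_hom_on free_scale s UNIV P (lincomb s ?v)"
    by (rule module_hom_lincomb[OF P vP])
  moreover have "lincomb s ?v ` UNIV = P"
  proof
    show "lincomb s ?v ` UNIV \<subseteq> P" using hom by (simp add: module_hom_on_def)
    show "P \<subseteq> lincomb s ?v ` UNIV"
    proof
      fix x assume "x \<in> P"
      then have "lincomb s ?v (Poly_Mapping.single x 1) = x" by (simp add: lincomb_single)
      then show "x \<in> lincomb s ?v ` UNIV" by (metis rangeI)
    qed
  qed
  ultimately show ?thesis unfolding projective_module_def using sec by blast
qed

section \<open>Projective resolutions of the trivial module\<close>

definition trivial_scale :: "('g::group_add \<Rightarrow>\<^sub>0 'r::ring_1) \<Rightarrow> 'r \<Rightarrow> 'r" where
  "trivial_scale x r = (\<Sum>g\<in>Poly_Mapping.keys x. Poly_Mapping.lookup x g) * r"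

record ('s, 'r, 'm) resolution =
  rscale :: "'s \<Rightarrow> 'm \<Rightarrow> 'm"
  rmod :: "nat \<Rightarrow> 'm set"
  rbd :: "nat \<Rightarrow> 'm \<Rightarrow> 'm" \<comment> \<open>\<open>rbd X k\<close> maps \<open>rmod X k\<close> to \<open>rmod X (k - 1)\<close>; \<open>rbd X 0\<close> is irrelevant\<close>
  raug :: "'m \<Rightarrow> 'r"

definition projective_resolution ::
  "('g::group_add \<Rightarrow>\<^sub>0 'r::ring_1, 'r, 'm::ab_group_add) resolution \<Rightarrow> bool" where
  "projective_resolution X \<longleftrightarrow>
     left_module (rscale X) \<and>
     (\<forall>k. submodule (rscale X) (rmod X k) \<and> projective_module (rscale X) (rmod X k)) \<and>
     (\<forall>k. module_hom_on (rscale X) (rscale X) (rmod X (Suc k)) (rmod X k) (rbd X (Suc k))) \<and>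
     module_hom_on (rscale X) trivial_scale (rmod X 0) UNIV (raug X) \<and>
     (\<forall>k. {x \<in> rmod X (Suc k). rbd X (Suc k) x = 0} =
            rbd X (Suc (Suc k)) ` rmod X (Suc (Suc k))) \<and>
     {x \<in> rmod X 0. raug X x = 0} = rbd X 1 ` rmod X 1 \<and>
     raug X ` rmod X 0 = UNIV"

section \<open>Isoperimetric functions\<close>

text \<open>\<open>B\<close> and \<open>B'\<close> are the fixed bases of \<open>C\<^sub>n\<close> and \<open>C\<^sub>n\<^sub>+\<^sub>1\<close>.\<close>

definition n_admissible ::
  "nat \<Rightarrow> ('g::group_add \<Rightarrow>\<^sub>0 'r::ring_1, 'r, 'm::ab_group_add) resolution \<Rightarrow> 'm set \<Rightarrow> 'm set \<Rightarrow> bool" where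
  "n_admissible n X B B' \<longleftrightarrow> projective_resolution X \<and>
     finite B \<and> module_basis (rscale X) (rmod X n) B \<and>
     finite B' \<and> module_basis (rscale X) (rmod X (n + 1)) B'"

text \<open>The \<open>\<ell>\<^sup>1\<close>-norm for the \<open>R\<close>-basis \<open>B \<times> G\<close> of the free \<open>RG\<close>-module with \<open>RG\<close>-basis \<open>B\<close>.\<close>

definition l1_norm ::
  "('r::ring_1 \<Rightarrow> real) \<Rightarrow> (('g::group_add \<Rightarrow>\<^sub>0 'r) \<Rightarrow> 'm::ab_group_add \<Rightarrow> 'm) \<Rightarrow> 'm set \<Rightarrow> 'm \<Rightarrow> real"
where
  "l1_norm nrm scale B x = (let \<phi> = coords scale B x in
     \<Sum>b\<in>Poly_Mapping.keys \<phi>. \<Sum>g\<in>Poly_Mapping.keys (Poly_Mapping.lookup \<phi> b).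
       nrm (Poly_Mapping.lookup (Poly_Mapping.lookup \<phi> b) g))"

definition filling_norm ::
  "('r::ring_1 \<Rightarrow> real) \<Rightarrow> nat \<Rightarrow> ('g::group_add \<Rightarrow>\<^sub>0 'r, 'r, 'm::ab_group_add) resolution \<Rightarrow> 'm set \<Rightarrow> 'm \<Rightarrow> real"
where
  "filling_norm nrm n X B' b =
     Inf {l1_norm nrm (rscale X) B' c | c. c \<in> rmod X (n + 1) \<and> rbd X (n + 1) c = b}"

definition isoperimetric ::
  "('r::ring_1 \<Rightarrow> real) \<Rightarrow> nat \<Rightarrow> ('g::group_add \<Rightarrow>\<^sub>0 'r, 'r, 'm::ab_group_add) resolution \<Rightarrow>
   'm set \<Rightarrow> 'm set \<Rightarrow> real \<Rightarrow> ennreal" where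
  "isoperimetric nrm n X B B' l =
     (SUP b \<in> {b \<in> rbd X (n + 1) ` rmod X (n + 1). l1_norm nrm (rscale X) B b \<le> l}.
        ennreal (filling_norm nrm n X B' b))"

section \<open>Admissible groups\<close>

text \<open>
  \<open>M\<close> is \<open>R[S]\<close>, with the elements of \<open>S\<close> viewed inside \<open>M\<close>: \<open>S\<close> is an \<open>R\<close>-basis
  permuted by \<open>G\<close>, with finite stabilizers. Here \<open>single g 1\<close> is \<open>g\<close> as an element of \<open>RG\<close>
  and \<open>single 0 a\<close> is \<open>a \<in> R\<close> as an element of \<open>RG\<close>.
\<close>

definition proper_permutation_basis ::
  "(('g::group_add \<Rightarrow>\<^sub>0 'r::ring_1) \<Rightarrow> 'm::ab_group_add \<Rightarrow> 'm) \<Rightarrow> 'm set \<Rightarrow> 'm set \<Rightarrow> bool" where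
  "proper_permutation_basis scale M S \<longleftrightarrow>
     module_basis (\<lambda>a. scale (Poly_Mapping.single 0 a)) M S \<and>
     (\<forall>g. \<forall>s\<in>S. scale (Poly_Mapping.single g 1) s \<in> S) \<and>
     (\<forall>s\<in>S. finite {g. scale (Poly_Mapping.single g 1) s = s})"

definition fg_proper_permutation_module ::
  "(('g::group_add \<Rightarrow>\<^sub>0 'r::ring_1) \<Rightarrow> 'm::ab_group_add \<Rightarrow> 'm) \<Rightarrow> 'm set \<Rightarrow> bool" where
  "fg_proper_permutation_module scale M \<longleftrightarrow>
     finitely_generated scale M \<and> (\<exists>S. proper_permutation_basis scale M S)"

text \<open>
  \<open>G\<close> is \<open>(n+1)\<close>-dimensional admissible over \<open>R\<close> iff it has a resolution with the following
  property, in some ambient type.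
\<close>

definition dim_admissible ::
  "nat \<Rightarrow> ('g::group_add \<Rightarrow>\<^sub>0 'r::ring_1, 'r, 'm::ab_group_add) resolution \<Rightarrow> bool" where
  "dim_admissible n X \<longleftrightarrow> projective_resolution X \<and>
     fg_proper_permutation_module (rscale X) (rmod X n) \<and>
     fg_proper_permutation_module (rscale X) (rmod X (n + 1)) \<and>
     inj_on (rbd X (n + 1)) (rmod X (n + 1))"

section \<open>Quasi-isometric groups\<close>

definition generates :: "'g::group_add set \<Rightarrow> bool" where
  "generates S \<longleftrightarrow> (\<forall>g. \<exists>xs. set xs \<subseteq> S \<union> uminus ` S \<and> sum_list xs = g)"

definition word_length :: "'g::group_add set \<Rightarrow> 'g \<Rightarrow> nat" where
  "word_length S g =
     (LEAST k. \<exists>xs. length xs = k \<and> set xs \<subseteq> S \<union> uminus ` S \<and> sum_list xs = g)"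

definition word_dist :: "'g::group_add set \<Rightarrow> 'g \<Rightarrow> 'g \<Rightarrow> real" where
  "word_dist S g h = real (word_length S (- g + h))"

definition quasi_isometry ::
  "('a \<Rightarrow> 'a \<Rightarrow> real) \<Rightarrow> ('b \<Rightarrow> 'b \<Rightarrow> real) \<Rightarrow> ('a \<Rightarrow> 'b) \<Rightarrow> bool" where
  "quasi_isometry d d' f \<longleftrightarrow> (\<exists>K A. K \<ge> 1 \<and> A \<ge> 0 \<and>
     (\<forall>x y. d x y / K - A \<le> d' (f x) (f y) \<and> d' (f x) (f y) \<le> K * d x y + A) \<and>
     (\<forall>z. \<exists>x. d' (f x) z \<le> A))"

definition quasi_isometric_groups :: "'g::group_add itself \<Rightarrow> 'h::group_add itself \<Rightarrow> bool" where
  "quasi_isometric_groups G H \<longleftrightarrow>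
     (\<exists>(S :: 'g set) (T :: 'h set) f. finite S \<and> generates S \<and> finite T \<and> generates T \<and>
        quasi_isometry (word_dist S) (word_dist T) f)"

section \<open>Growth rate classes\<close>

text \<open>Only the values at nonnegative arguments matter.\<close>

definition growth_le :: "(real \<Rightarrow> real) \<Rightarrow> (real \<Rightarrow> real) \<Rightarrow> bool" where
  "growth_le f g \<longleftrightarrow> (\<exists>C>0. \<forall>l\<ge>0. f l \<le> C * g (C * l + C) + C * l + C)"

definition same_growth_class :: "(real \<Rightarrow> real) \<Rightarrow> (real \<Rightarrow> real) \<Rightarrow> bool" where
  "same_growth_class f g \<longleftrightarrow> growth_le f g \<and> growth_le g f"

end

theory Submission
  imports Defs
begin

text \<open>
  Given a quasi-isometry \<open>\<phi>: G \<rightarrow> H\<close>, call a coefficient-linear map \<open>f\<close> from an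
  \<open>RG\<close>-module to an \<open>RH\<close>-module controlled if \<open>{\<phi>(g)\<inverse> f(g x) | g \<in> G}\<close> is finite for
  every \<open>x\<close>. Controlled maps compose, include the equivariant maps, and, when defined on a
  projective module, lift along \<open>RH\<close>-linear surjections. So the comparison theorem for projective
  resolutions provides controlled chain maps between resolutions over \<open>G\<close> and \<open>H\<close>, mutually
  inverse up to controlled homotopy, without any finiteness in degrees below \<open>n\<close>. On finitely
  generated free modules controlled maps are bounded for the \<open>\<ell>\<^sup>1\<close>-norms, and a cycle is filled
  by transporting back a filling of its image and correcting by the homotopy.
\<close>

section \<open>Coefficientwise linear maps\<close>

text \<open>Restriction of scalars from the group ring to its coefficient ring; \<open>0\<close> is
  the group identity.\<close>

abbreviation coeff_scale ::
  "(('g::group_add \<Rightarrow>\<^sub>0 'r::ring_1) \<Rightarrow> 'm \<Rightarrow> 'm) \<Rightarrow> 'r \<Rightarrow> 'm \<Rightarrow> 'm" where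
  "coeff_scale s a \<equiv> s (Poly_Mapping.single 0 a)"

abbreviation gact :: "(('g::group_add \<Rightarrow>\<^sub>0 'r::ring_1) \<Rightarrow> 'm \<Rightarrow> 'm) \<Rightarrow> 'g \<Rightarrow> 'm \<Rightarrow> 'm" where
  "gact s g \<equiv> s (Poly_Mapping.single g 1)"

text \<open>A constant multiplies every coefficient from the left, so facts about
  \<open>free_scale\<close> become available for elements of the group ring itself.\<close>

lemma single_0_times: "Poly_Mapping.single 0 a * p = free_scale a p"
  for p :: "'g::group_add \<Rightarrow>\<^sub>0 'r::ring_1"
  by (simp add: free_scale_def mult_map_scale_conv_mult)

lemma sum_singles:
  "p = (\<Sum>g\<in>Poly_Mapping.keys p. Poly_Mapping.single g (Poly_Mapping.lookup p g))"
  by (rule poly_mapping_eqI)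
    (simp add: lookup_sum lookup_single when_def in_keys_iff if_distrib sum.If_cases cong: if_cong)

lemma left_module_coeff_scale:
  assumes "left_module t" shows "left_module (coeff_scale t)"
proof -
  interpret left_module t by fact
  show ?thesis
    by unfold_locales
      (simp_all add: scale_add_right single_add scale_add_left scale_scale mult_single scale_one)
qed

lemma submodule_coeff_scale: "submodule t M \<Longrightarrow> submodule (coeff_scale t) M"
  by (simp add: submodule_def)

lemma module_hom_on_coeff_scale:
  "module_hom_on s t M N f \<Longrightarrow> module_hom_on (coeff_scale s) (coeff_scale t) M N f"
  by (simp add: module_hom_on_def)

section \<open>Sums and differences in submodules and under homomorphisms\<close>

lemma submodule_sum:
  assumes "submodule s M" "\<And>i. i \<in> A \<Longrightarrow> x i \<in> M"
  shows "sum x A \<in> M"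
  using assms(2)
  by (induction A rule: infinite_finite_induct) (use assms(1) in \<open>auto simp: submodule_def\<close>)

text \<open>\<open>submodule\<close> asks only for sums and scalar multiples, so negatives are
  obtained from the scalar \<open>- 1\<close>.\<close>

lemma submodule_diff:
  assumes "left_module s" "submodule s M" "x \<in> M" "y \<in> M"
  shows "x - y \<in> M"
proof -
  interpret left_module s by fact
  have "s (- 1) y = - y"
    using scale_add_left[of "- 1" 1 y] by (simp add: scale_one scale_zero_left eq_neg_iff_add_eq_0)
  then have "- y \<in> M" using assms by (metis submodule_def)
  then have "x + - y \<in> M" using assms unfolding submodule_def by blast
  then show ?thesis by simp
qed

lemma module_hom_on_zero:
  assumes "module_hom_on s t M N f" "0 \<in> M" shows "f 0 = 0"
  using assms unfolding module_hom_on_def by (metis add_cancel_left_left)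

lemma module_hom_on_minus:
  assumes "left_module s" "submodule s M" "module_hom_on s t M N f" "x \<in> M" "y \<in> M"
  shows "f (x - y) = f x - f y"
proof -
  have "x - y \<in> M" using submodule_diff assms by blast
  then have "f (x - y + y) = f (x - y) + f y" using assms unfolding module_hom_on_def by blast
  then show ?thesis by simp
qed

lemma module_hom_on_sum:
  assumes "submodule s M" "module_hom_on s t M N f" "\<And>i. i \<in> A \<Longrightarrow> x i \<in> M"
  shows "f (sum x A) = (\<Sum>i\<in>A. f (x i))"
  using assms(3)
proof (induction A rule: infinite_finite_induct)
  case (insert i A)
  then have "sum x A \<in> M" by (intro submodule_sum[OF assms(1)]) auto
  then show ?case using insert assms(2) by (simp add: module_hom_on_def)
qed (use assms module_hom_on_zero in \<open>auto simp: submodule_def\<close>)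

context left_module
begin

lemma scale_sum_left: "scale (sum f A) x = (\<Sum>i\<in>A. scale (f i) x)"
  by (induction A rule: infinite_finite_induct) (auto simp: scale_zero_left scale_add_left)

lemma scale_diff_right: "scale a (x - y) = scale a x - scale a y"
  using scale_add_right[of a "x - y" y] by (simp add: algebra_simps)

end

section \<open>Group ring modules as coefficient modules with a group action\<close>

locale group_ring_module = left_module t
  for t :: "('g::group_add \<Rightarrow>\<^sub>0 'r::ring_1) \<Rightarrow> 'm::ab_group_add \<Rightarrow> 'm"
begin

sublocale coeff: left_module "coeff_scale t"
  by (rule left_module_coeff_scale) (rule left_module_axioms)

lemma gact_gact: "gact t g (gact t h x) = gact t (g + h) x"
  by (simp add: scale_scale mult_single)

lemma gact_coeff_scale: "gact t g (coeff_scale t a x) = coeff_scale t a (gact t g x)"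
  by (simp add: scale_scale mult_single)

lemma scale_conv_lincomb: "t p x = lincomb (coeff_scale t) (\<lambda>g. gact t g x) p"
proof -
  have "t p x = (\<Sum>g\<in>Poly_Mapping.keys p. t (Poly_Mapping.single g (Poly_Mapping.lookup p g)) x)"
    by (subst sum_singles) (rule scale_sum_left)
  then show ?thesis by (simp add: lincomb_def scale_scale mult_single)
qed

end

text \<open>The free module over the group ring is read here as a free module over the coefficients,
  with one basis vector for each pair \<open>b\<close>, \<open>g\<close>. The vectors
  \<open>v b g\<close> are arbitrary: a map that is not equivariant is determined only by its values
  on all translates of the basis.\<close>

definition rlincomb ::
  "(('g::group_add \<Rightarrow>\<^sub>0 'r::ring_1) \<Rightarrow> 'm::ab_group_add \<Rightarrow> 'm) \<Rightarrow> ('b \<Rightarrow> 'g2 \<Rightarrow> 'm) \<Rightarrow>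
   ('b \<Rightarrow>\<^sub>0 'g2 \<Rightarrow>\<^sub>0 'r) \<Rightarrow> 'm" where
  "rlincomb t v \<Phi> =
     (\<Sum>b\<in>Poly_Mapping.keys \<Phi>. lincomb (coeff_scale t) (v b) (Poly_Mapping.lookup \<Phi> b))"

context group_ring_module
begin

lemma rlincomb_superset:
  assumes "finite A" "Poly_Mapping.keys \<Phi> \<subseteq> A"
  shows "rlincomb t v \<Phi> = (\<Sum>b\<in>A. lincomb (coeff_scale t) (v b) (Poly_Mapping.lookup \<Phi> b))"
  unfolding rlincomb_def using assms
  by (intro sum.mono_neutral_left) (auto simp: in_keys_iff lincomb_def)

lemma rlincomb_add: "rlincomb t v (\<Phi> + \<Psi>) = rlincomb t v \<Phi> + rlincomb t v \<Psi>"
proof -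
  let ?A = "Poly_Mapping.keys \<Phi> \<union> Poly_Mapping.keys \<Psi>"
  have "Poly_Mapping.keys (\<Phi> + \<Psi>) \<subseteq> ?A"
    by (rule Poly_Mapping.keys_add)
  then show ?thesis
    by (simp add: rlincomb_superset[of ?A] lookup_add coeff.lincomb_add sum.distrib)
qed

lemma rlincomb_coeff_scale:
  "rlincomb t v (coeff_scale free_scale a \<Phi>) = coeff_scale t a (rlincomb t v \<Phi>)"
  for v :: "'b \<Rightarrow> 'g2::group_add \<Rightarrow> 'm"
proof -
  have "Poly_Mapping.keys (coeff_scale free_scale a \<Phi>) \<subseteq> Poly_Mapping.keys \<Phi>"
    by (auto simp: in_keys_iff lookup_free_scale)
  then show ?thesis
    by (simp add: rlincomb_superset[of "Poly_Mapping.keys \<Phi>"] lookup_free_scale single_0_times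
        coeff.lincomb_free_scale scale_sum_right)
qed

lemma rlincomb_single: "rlincomb t v (Poly_Mapping.single b (Poly_Mapping.single g 1)) = v b g"
  by (subst rlincomb_superset[of "{b}"]) (auto simp: coeff.lincomb_single)

lemma rlincomb_in:
  assumes "submodule (coeff_scale t) M" "\<And>b g. b \<in> Poly_Mapping.keys \<Phi> \<Longrightarrow> v b g \<in> M"
  shows "rlincomb t v \<Phi> \<in> M"
  unfolding rlincomb_def lincomb_def
  by (intro submodule_sum[OF assms(1)]) (use assms in \<open>auto simp: submodule_def\<close>)

lemma module_hom_rlincomb:
  fixes v :: "'b \<Rightarrow> 'g2::group_add \<Rightarrow> 'm"
  assumes "submodule (coeff_scale t) M" "\<And>b g. v b g \<in> M"
  shows "module_hom_on (coeff_scale free_scale) (coeff_scale t) UNIV M (rlincomb t v)"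
  using assms
  by (auto simp: module_hom_on_def rlincomb_add rlincomb_coeff_scale intro!: rlincomb_in)

lemma lincomb_conv_rlincomb: "lincomb t v \<Phi> = rlincomb t (\<lambda>b g. gact t g (v b)) \<Phi>"
  unfolding rlincomb_def by (subst lincomb_def) (simp add: scale_conv_lincomb[symmetric])

end

text \<open>Membership in \<open>M\<close> is asked only over the support of \<open>\<Phi>\<close>,
  so that the lemma applies to coordinates with respect to a basis, where other indices need not
  belong to the module.\<close>

lemma hom_rlincomb:
  assumes M: "submodule (coeff_scale s) M"
    and f: "module_hom_on (coeff_scale s) (coeff_scale t) M N f"
    and v: "\<And>b g. b \<in> Poly_Mapping.keys \<Phi> \<Longrightarrow> v b g \<in> M"
  shows "f (rlincomb s v \<Phi>) = rlincomb t (\<lambda>b g. f (v b g)) \<Phi>"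
proof -
  have *: "coeff_scale s a (v b g) \<in> M" if "b \<in> Poly_Mapping.keys \<Phi>" for a b g
    using M v[OF that] by (auto simp: submodule_def)
  have "f (lincomb (coeff_scale s) (v b) p) = lincomb (coeff_scale t) (\<lambda>g. f (v b g)) p"
    if "b \<in> Poly_Mapping.keys \<Phi>" for b p
    unfolding lincomb_def
    by (subst module_hom_on_sum[OF M f]) (use *[OF that] f v[OF that] in \<open>auto simp: module_hom_on_def\<close>)
  moreover have "lincomb (coeff_scale s) (v b) p \<in> M" if "b \<in> Poly_Mapping.keys \<Phi>" for b p
    unfolding lincomb_def by (intro submodule_sum[OF M]) (use *[OF that] in auto)
  ultimately show ?thesis
    unfolding rlincomb_def by (subst module_hom_on_sum[OF M f]) auto
qed

lemma group_ring_module_free_scale: "group_ring_module free_scale"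
  by (simp add: group_ring_module_def left_module_free_scale)

lemma gact_free_scale_single:
  "gact free_scale g (Poly_Mapping.single b p) = Poly_Mapping.single b (Poly_Mapping.single g 1 * p)"
  by (rule poly_mapping_eqI) (simp add: lookup_free_scale lookup_single when_def)

text \<open>The identity is linear over the group ring, hence determined by its values on the free
  basis; splitting into translates then yields the expansion over the coefficient basis.\<close>

lemma free_eq_rlincomb:
  "\<Phi> = rlincomb free_scale (\<lambda>b g. Poly_Mapping.single b (Poly_Mapping.single g 1)) \<Phi>"
proof -
  interpret group_ring_module free_scale by (rule group_ring_module_free_scale)
  have "\<Phi> = lincomb free_scale (\<lambda>b. Poly_Mapping.single b 1) \<Phi>"
    by (rule module_hom_on_free[OF left_module_free_scale, of UNIV "\<lambda>x. x"])
      (simp add: module_hom_on_def)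
  then show ?thesis
    by (simp add: lincomb_conv_rlincomb gact_free_scale_single)
qed

section \<open>Controlled maps\<close>

text \<open>A metric-free form of uniform expansiveness: points that differ by a fixed
  \<open>g'\<close> are sent to points whose difference takes finitely many values. For word metrics
  of finitely generated groups, finite means bounded.\<close>

definition coarse_map :: "('g::group_add \<Rightarrow> 'h::group_add) \<Rightarrow> bool" where
  "coarse_map \<phi> \<longleftrightarrow> (\<forall>g'. finite (range (\<lambda>g. - \<phi> g + \<phi> (g + g'))))"

text \<open>
  The weakening of equivariance that survives a passage from \<open>G\<close> to \<open>H\<close> along \<open>\<phi>\<close>: up to finitely
  many values, the translate of the map by \<open>g\<close> and \<open>\<phi> g\<close> does not depend on \<open>g\<close>.
\<close>

definition controlled ::
  "(('g::group_add \<Rightarrow>\<^sub>0 'r::ring_1) \<Rightarrow> 'm::ab_group_add \<Rightarrow> 'm) \<Rightarrow>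
   (('h::group_add \<Rightarrow>\<^sub>0 'r) \<Rightarrow> 'n::ab_group_add \<Rightarrow> 'n) \<Rightarrow> ('g \<Rightarrow> 'h) \<Rightarrow>
   'm set \<Rightarrow> 'n set \<Rightarrow> ('m \<Rightarrow> 'n) \<Rightarrow> bool" where
  "controlled s t \<phi> M N f \<longleftrightarrow> module_hom_on (coeff_scale s) (coeff_scale t) M N f \<and>
     (\<forall>x\<in>M. finite (range (\<lambda>g. gact t (- \<phi> g) (f (gact s g x)))))"

section \<open>Closure properties of finite ranges and of controlled maps\<close>

lemma finite_range_combine:
  assumes "finite (range u)" "finite (range v)"
  shows "finite (range (\<lambda>g. F (u g) (v g)))"
proof (rule finite_subset)
  show "range (\<lambda>g. F (u g) (v g)) \<subseteq> (\<lambda>(x, y). F x y) ` (range u \<times> range v)" by auto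
qed (use assms in auto)

lemma finite_range_compose:
  assumes "finite (range u)" shows "finite (range (\<lambda>g. F (u g)))"
  using finite_range_combine[OF assms assms, of "\<lambda>x _. F x"] .

lemma finite_range_family:
  assumes "finite (range u)" "\<And>y. y \<in> range u \<Longrightarrow> finite (range (F y))"
  shows "finite (range (\<lambda>g. F (u g) (v g)))"
proof (rule finite_subset)
  show "range (\<lambda>g. F (u g) (v g)) \<subseteq> (\<Union>y\<in>range u. range (F y))" by auto
qed (rule finite_UN_I[OF assms])

lemma controlled_hom: "controlled s t \<phi> M N f \<Longrightarrow> module_hom_on (coeff_scale s) (coeff_scale t) M N f"
  by (simp add: controlled_def)

lemma controlled_in: "controlled s t \<phi> M N f \<Longrightarrow> x \<in> M \<Longrightarrow> f x \<in> N"
  by (auto simp: controlled_def module_hom_on_def)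

lemma controlled_zero:
  assumes "controlled s t \<phi> M N f" "submodule s M" shows "f 0 = 0"
  using assms controlled_hom module_hom_on_zero by (fastforce simp: submodule_def)

lemma controlled_mono_codomain:
  assumes "controlled s t \<phi> M N f" "\<And>x. x \<in> M \<Longrightarrow> f x \<in> N'"
  shows "controlled s t \<phi> M N' f"
  using assms by (auto simp: controlled_def module_hom_on_def)

text \<open>Equivariance cancels the two translations, so the range in question is the single value
  \<open>f x\<close>.\<close>

lemma equivariant_controlled:
  assumes "left_module t" "module_hom_on s t M N f"
  shows "controlled s t (\<lambda>g. g) M N f"
proof -
  interpret group_ring_module t using assms(1) by (simp add: group_ring_module_def)
  have "gact t (- g) (f (gact s g x)) = f x" if "x \<in> M" for g x
    using assms(2) that by (simp add: module_hom_on_def gact_gact scale_one)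
  then show ?thesis
    using module_hom_on_coeff_scale[OF assms(2)] by (simp add: controlled_def)
qed

text \<open>Write \<open>f (gact s g x)\<close> as the \<open>\<phi> g\<close>-translate of a value
  that ranges over a finite set. For each such value the control of \<open>f'\<close>, evaluated at
  the group elements \<open>\<phi> g\<close>, leaves finitely many results.\<close>

lemma controlled_compose:
  assumes "left_module t" and M: "submodule s M" and M': "submodule t M'"
    and f: "controlled s t \<phi> M M' f" and f': "controlled t u \<psi> M' N f'"
  shows "controlled s u (\<lambda>g. \<psi> (\<phi> g)) M N (\<lambda>x. f' (f x))"
proof -
  interpret group_ring_module t using assms(1) by (simp add: group_ring_module_def)
  have "finite (range (\<lambda>g. gact u (- \<psi> (\<phi> g)) (f' (f (gact s g x)))))" if x: "x \<in> M" for x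
  proof -
    let ?d = "\<lambda>g. gact t (- \<phi> g) (f (gact s g x))"
    have "gact s g x \<in> M" for g using x M by (simp add: submodule_def)
    then have "?d g \<in> M'" for g
      using controlled_in[OF f] M' by (auto simp: submodule_def)
    then have fin: "finite (range (\<lambda>h. gact u (- \<psi> h) (f' (gact t h y))))" if "y \<in> range ?d" for y
      using f' that by (auto simp: controlled_def)
    have "finite (range (\<lambda>g. gact u (- \<psi> (\<phi> g)) (f' (gact t (\<phi> g) (?d g)))))"
      by (rule finite_range_family[of ?d "\<lambda>y h. gact u (- \<psi> h) (f' (gact t h y))"])
        (use f x fin in \<open>auto simp: controlled_def\<close>)
    then show ?thesis by (simp add: gact_gact scale_one)
  qed
  then show ?thesis using f f'
    by (auto simp: controlled_def module_hom_on_def image_subset_iff)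
qed

lemma controlled_equivariant_compose:
  assumes "left_module s'" "submodule s M" "submodule s' M'" "module_hom_on s s' M M' e"
    "controlled s' t \<phi> M' N f"
  shows "controlled s t \<phi> M N (\<lambda>x. f (e x))"
  using controlled_compose[OF assms(1-3) equivariant_controlled[OF assms(1,4)] assms(5)] by simp

text \<open>Translation by \<open>- \<psi> g\<close> is translation by \<open>- \<phi> g\<close>
  followed by \<open>- \<psi> g + \<phi> g\<close>, and both contribute finitely many
  possibilities.\<close>

lemma controlled_close:
  assumes "left_module t" and f: "controlled s t \<phi> M N f"
    and "finite (range (\<lambda>g. - \<psi> g + \<phi> g))"
  shows "controlled s t \<psi> M N f"
proof -
  interpret group_ring_module t using assms(1) by (simp add: group_ring_module_def)
  have "finite (range (\<lambda>g. gact t (- \<psi> g) (f (gact s g x))))" if "x \<in> M" for x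
  proof -
    have "finite (range (\<lambda>g. gact t (- \<psi> g + \<phi> g) (gact t (- \<phi> g) (f (gact s g x)))))"
      by (rule finite_range_combine[OF assms(3), where F = "gact t"])
        (use f that in \<open>auto simp: controlled_def\<close>)
    then show ?thesis by (simp add: gact_gact add.assoc)
  qed
  then show ?thesis using f by (auto simp: controlled_def)
qed

lemma controlled_diff:
  assumes "left_module t" "submodule s M" "submodule t N"
    and f: "controlled s t \<phi> M N f" and f': "controlled s t \<phi> M N f'"
  shows "controlled s t \<phi> M N (\<lambda>x. f x - f' x)"
proof -
  interpret group_ring_module t using assms(1) by (simp add: group_ring_module_def)
  have "finite (range (\<lambda>g. gact t (- \<phi> g) (f (gact s g x) - f' (gact s g x))))" if "x \<in> M" for x
    unfolding scale_diff_right
    by (rule finite_range_combine[where F = "(-)"]) (use f f' that in \<open>auto simp: controlled_def\<close>)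
  then show ?thesis
    using f f' submodule_diff[OF assms(1,3)]
    by (auto simp: controlled_def module_hom_on_def image_subset_iff coeff.scale_diff_right)
qed

text \<open>
  Control can be checked on the basis elements \<open>b\<close>, because the elements with finitely many translates
  form a submodule over the coefficient ring.
\<close>

lemma controlled_rlincomb:
  assumes t: "left_module t" and M: "submodule t M" and \<phi>: "coarse_map \<phi>"
    and wM: "\<And>b g. w b g \<in> M" and w: "\<And>b. finite (range (w b))"
  shows "controlled free_scale t \<phi> UNIV M (rlincomb t (\<lambda>b g. gact t (\<phi> g) (w b g)))"
proof -
  interpret group_ring_module t using t by (simp add: group_ring_module_def)
  interpret F: group_ring_module free_scale by (rule group_ring_module_free_scale)
  let ?v = "\<lambda>b g. gact t (\<phi> g) (w b g)"
  let ?h = "rlincomb t ?v"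
  define T where "T g \<Phi> = gact t (- \<phi> g) (?h (gact free_scale g \<Phi>))" for g \<Phi>
  define E where "E = {\<Phi>. finite (range (\<lambda>g. T g \<Phi>))}"
  have vM: "?v b g \<in> M" for b g using wM M by (simp add: submodule_def)
  have hom: "module_hom_on (coeff_scale free_scale) (coeff_scale t) UNIV M ?h"
    by (rule module_hom_rlincomb[OF submodule_coeff_scale[OF M] vM])
  have T_add: "T g (\<Phi> + \<Psi>) = T g \<Phi> + T g \<Psi>" for g \<Phi> \<Psi>
    by (simp add: T_def F.scale_add_right rlincomb_add scale_add_right)
  have T_scale: "T g (coeff_scale free_scale a \<Phi>) = coeff_scale t a (T g \<Phi>)" for g a \<Phi>
    by (simp add: T_def F.gact_coeff_scale rlincomb_coeff_scale gact_coeff_scale)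
  have T_zero: "T g 0 = 0" for g
    using T_add[of g 0 0] by simp
  have "submodule (coeff_scale free_scale) E"
    unfolding submodule_def E_def
    by (auto simp: T_add T_scale T_zero intro: finite_range_combine[where F = "(+)"] finite_range_compose[where F = "coeff_scale t _"])
  moreover have "Poly_Mapping.single b (Poly_Mapping.single g' 1) \<in> E" for b g'
  proof -
    \<comment> \<open>Translation by \<open>g\<close> moves the index \<open>g'\<close> to
      \<open>g + g'\<close>. What remains is a group element controlled by \<open>coarse_map\<close>
      acting on one of the finitely many values of \<open>w b\<close>.\<close>
    have "T g (Poly_Mapping.single b (Poly_Mapping.single g' 1)) =
        gact t (- \<phi> g + \<phi> (g + g')) (w b (g + g'))" for g
      by (simp add: T_def gact_free_scale_single mult_single rlincomb_single gact_gact)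
    moreover have "finite (range (\<lambda>g. gact t (- \<phi> g + \<phi> (g + g')) (w b (g + g'))))"
    proof (rule finite_range_combine[where F = "gact t"])
      show "finite (range (\<lambda>g. - \<phi> g + \<phi> (g + g')))" using \<phi> by (simp add: coarse_map_def)
      show "finite (range (\<lambda>g. w b (g + g')))" by (rule finite_subset[OF _ w[of b]]) auto
    qed
    ultimately show ?thesis by (simp add: E_def)
  qed
  ultimately have "\<Phi> \<in> E" for \<Phi>
    by (subst free_eq_rlincomb) (intro F.rlincomb_in)
  then show ?thesis
    using hom by (simp add: controlled_def E_def T_def)
qed

text \<open>As for ordinary projectives, one lifts on a free module of which \<open>P\<close> is a
  retract, but on all translates of the basis instead of the basis alone. Control of
  \<open>f\<close> leaves finitely many normalised values per basis element, and lifting these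
  values keeps the lift controlled. The conditions on \<open>u\<close> and \<open>N\<close> are
  immediate for the trivial module and for cycles.\<close>

lemma controlled_lifting:
  fixes s :: "('g::group_add \<Rightarrow>\<^sub>0 'r::ring_1) \<Rightarrow> 'm::ab_group_add \<Rightarrow> 'm"
    and t :: "('h::group_add \<Rightarrow>\<^sub>0 'r) \<Rightarrow> 'a::ab_group_add \<Rightarrow> 'a"
    and u :: "('h \<Rightarrow>\<^sub>0 'r) \<Rightarrow> 'b::ab_group_add \<Rightarrow> 'b"
  assumes t: "left_module t"
    and u: "\<And>h y. gact u h (gact u (- h) y) = y"
    and P: "projective_module s P" "submodule s P" "left_module s"
    and M: "submodule t M"
    and f: "controlled s u \<phi> P N f" and p: "module_hom_on t u M N p" and surj: "p ` M = N"
    and \<phi>: "coarse_map \<phi>"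
    and N: "\<And>h y. y \<in> N \<Longrightarrow> gact u h y \<in> N"
  shows "\<exists>h. controlled s t \<phi> P M h \<and> (\<forall>x\<in>P. p (h x) = f x)"
proof -
  interpret group_ring_module t using t by (simp add: group_ring_module_def)
  from P obtain i :: "'m \<Rightarrow> ('m \<Rightarrow>\<^sub>0 'g \<Rightarrow>\<^sub>0 'r)" and q where i: "module_hom_on s free_scale P UNIV i"
    and q: "module_hom_on free_scale s UNIV P q" and iq: "\<And>x. x \<in> P \<Longrightarrow> q (i x) = x"
    unfolding projective_module_def by blast
  have U: "submodule free_scale UNIV" by (simp add: submodule_def)
  let ?b = "\<lambda>b g. Poly_Mapping.single b (Poly_Mapping.single g 1)"
  have fq: "controlled free_scale u \<phi> UNIV N (\<lambda>x. f (q x))"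
    by (rule controlled_equivariant_compose[OF P(3) U P(2) q f])
  define d where "d b g = gact u (- \<phi> g) (f (q (?b b g)))" for b g
  have d_fin: "finite (range (d b))" for b
  proof -
    have "finite (range (\<lambda>g. gact u (- \<phi> g) (f (q (gact free_scale g (?b b 0))))))"
      using fq by (simp add: controlled_def)
    then show ?thesis by (simp add: gact_free_scale_single mult_single d_def)
  qed
  have dN: "d b g \<in> N" for b g
    unfolding d_def using controlled_in[OF fq] N by simp
  \<comment> \<open>The preimage is chosen per value \<open>y\<close> and not per group element;
    hence \<open>\<sigma> (d b g)\<close> takes finitely many values for fixed
    \<open>b\<close>.\<close>
  define \<sigma> where "\<sigma> y = (SOME m. m \<in> M \<and> p m = y)" for y
  have \<sigma>: "\<sigma> y \<in> M \<and> p (\<sigma> y) = y" if "y \<in> N" for y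
    unfolding \<sigma>_def by (rule someI_ex) (use that surj in auto)
  let ?v = "\<lambda>b g. gact t (\<phi> g) (\<sigma> (d b g))"
  let ?h = "rlincomb t ?v"
  have \<sigma>M: "\<sigma> (d b g) \<in> M" for b g using \<sigma> dN by blast
  then have vM: "?v b g \<in> M" for b g using M by (simp add: submodule_def)
  have h: "controlled free_scale t \<phi> UNIV M ?h"
    by (rule controlled_rlincomb[OF t M \<phi> \<sigma>M]) (rule finite_range_compose[where F = \<sigma>, OF d_fin])
  have pv: "p (?v b g) = f (q (?b b g))" for b g
  proof -
    have "p (?v b g) = gact u (\<phi> g) (p (\<sigma> (d b g)))"
      using p \<sigma>M by (simp add: module_hom_on_def)
    also have "\<dots> = f (q (?b b g))"
      using \<sigma> dN by (simp add: d_def u)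
    finally show ?thesis .
  qed
  have eq: "p (?h \<Phi>) = f (q \<Phi>)" for \<Phi>
  proof -
    have "p (?h \<Phi>) = rlincomb u (\<lambda>b g. p (?v b g)) \<Phi>"
      by (rule hom_rlincomb[OF submodule_coeff_scale[OF M] module_hom_on_coeff_scale[OF p] vM])
    also have "\<dots> = rlincomb u (\<lambda>b g. f (q (?b b g))) \<Phi>"
      by (simp add: pv)
    also have "\<dots> = f (q (rlincomb free_scale ?b \<Phi>))"
      by (rule hom_rlincomb[OF submodule_coeff_scale[OF U] controlled_hom[OF fq], symmetric]) simp
    finally show ?thesis by (simp add: free_eq_rlincomb[symmetric])
  qed
  have "controlled s t \<phi> P M (\<lambda>x. ?h (i x))"
    by (rule controlled_equivariant_compose[OF left_module_free_scale P(2) U i h])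
  moreover have "\<forall>x\<in>P. p (?h (i x)) = f x"
    by (simp add: eq iq)
  ultimately show ?thesis by blast
qed

section \<open>Controlled chain maps and homotopies\<close>

text \<open>With the kernel of the augmentation as the cycles of degree 0, exactness takes the same
  form in every degree.\<close>

definition cycles ::
  "('g::group_add \<Rightarrow>\<^sub>0 'r::ring_1, 'r, 'm::ab_group_add) resolution \<Rightarrow> nat \<Rightarrow> 'm set" where
  "cycles X k = {x \<in> rmod X k. if k = 0 then raug X x = 0 else rbd X k x = 0}"

lemma cycles_Suc: "x \<in> cycles X (Suc k) \<longleftrightarrow> x \<in> rmod X (Suc k) \<and> rbd X (Suc k) x = 0"
  by (simp add: cycles_def)

context
  fixes X :: "('g::group_add \<Rightarrow>\<^sub>0 'r::ring_1, 'r, 'm::ab_group_add) resolution"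
  assumes X: "projective_resolution X"
begin

lemma resolution_left_module: "left_module (rscale X)"
  and resolution_submodule: "submodule (rscale X) (rmod X k)"
  and resolution_projective: "projective_module (rscale X) (rmod X k)"
  and resolution_bd: "module_hom_on (rscale X) (rscale X) (rmod X (Suc k)) (rmod X k) (rbd X (Suc k))"
  and resolution_aug: "module_hom_on (rscale X) trivial_scale (rmod X 0) UNIV (raug X)"
  and resolution_aug_surj: "raug X ` rmod X 0 = UNIV"
  using X by (auto simp: projective_resolution_def)

lemma resolution_exact: "rbd X (Suc k) ` rmod X (Suc k) = cycles X k"
  using X by (cases k) (auto simp: projective_resolution_def cycles_def)

lemma resolution_bd_cycles: "x \<in> rmod X (Suc k) \<Longrightarrow> rbd X (Suc k) x \<in> cycles X k"
  using resolution_exact by blast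

lemma resolution_bd_onto_cycles:
  "module_hom_on (rscale X) (rscale X) (rmod X (Suc k)) (cycles X k) (rbd X (Suc k))"
  using resolution_bd resolution_bd_cycles by (auto simp: module_hom_on_def)

text \<open>By exactness every cycle is a boundary, and boundaries are visibly closed under scalars;
  this covers degree 0 without computing in the trivial module.\<close>

lemma cycles_scale: "x \<in> cycles X k \<Longrightarrow> rscale X a x \<in> cycles X k"
proof -
  assume "x \<in> cycles X k"
  then obtain y where y: "y \<in> rmod X (Suc k)" "x = rbd X (Suc k) y"
    using resolution_exact by blast
  then have "rscale X a x = rbd X (Suc k) (rscale X a y)" "rscale X a y \<in> rmod X (Suc k)"
    using resolution_bd[of k] resolution_submodule[of "Suc k"]
    by (simp_all add: module_hom_on_def submodule_def)
  then show ?thesis using resolution_bd_cycles by simp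
qed

lemma controlled_lifting_cycles:
  assumes "projective_module s P" "submodule s P" "left_module s" "coarse_map \<phi>"
    and "controlled s (rscale X) \<phi> P (cycles X k) f"
  shows "\<exists>h. controlled s (rscale X) \<phi> P (rmod X (Suc k)) h \<and> (\<forall>x\<in>P. rbd X (Suc k) (h x) = f x)"
proof -
  interpret group_ring_module "rscale X"
    using resolution_left_module by (simp add: group_ring_module_def)
  show ?thesis
    by (rule controlled_lifting[OF resolution_left_module _ assms(1-3) resolution_submodule assms(5)
          resolution_bd_onto_cycles resolution_exact assms(4) cycles_scale])
      (simp add: gact_gact scale_one)
qed

text \<open>A full homotopy satisfies \<open>f k = \<partial>\<sigma> + \<sigma>\<partial>\<close>.
  Only its restriction to cycles is recorded, where the second summand vanishes; this is enough for
  the induction and for filling cycles.\<close>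

lemma controlled_null_homotopy:
  assumes f: "\<And>k. controlled (rscale X) (rscale X) (\<lambda>g. g) (rmod X k) (rmod X k) (f k)"
    and aug: "\<And>x. x \<in> rmod X 0 \<Longrightarrow> raug X (f 0 x) = 0"
    and chain: "\<And>k x. x \<in> rmod X (Suc k) \<Longrightarrow> rbd X (Suc k) (f (Suc k) x) = f k (rbd X (Suc k) x)"
  shows "\<exists>\<sigma>. controlled (rscale X) (rscale X) (\<lambda>g. g) (rmod X k) (rmod X (Suc k)) \<sigma> \<and>
    (\<forall>x\<in>cycles X k. rbd X (Suc k) (\<sigma> x) = f k x)"
proof (induction k)
  case 0
  have "controlled (rscale X) (rscale X) (\<lambda>g. g) (rmod X 0) (cycles X 0) (f 0)"
    by (rule controlled_mono_codomain[OF f]) (use aug controlled_in[OF f] in \<open>auto simp: cycles_def\<close>)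
  from controlled_lifting_cycles[OF resolution_projective resolution_submodule resolution_left_module _ this]
  show ?case by (auto simp: coarse_map_def cycles_def add.assoc[symmetric])
next
  case (Suc k)
  then obtain \<sigma> where \<sigma>: "controlled (rscale X) (rscale X) (\<lambda>g. g) (rmod X k) (rmod X (Suc k)) \<sigma>"
    and \<sigma>_bd: "\<And>x. x \<in> cycles X k \<Longrightarrow> rbd X (Suc k) (\<sigma> x) = f k x" by blast
  \<comment> \<open>Subtracting the previous homotopy produces cycles: a boundary is a cycle, so the
    induction hypothesis applies to it and cancels the chain map term.\<close>
  let ?f = "\<lambda>x. f (Suc k) x - \<sigma> (rbd X (Suc k) x)"
  have \<sigma>bd: "controlled (rscale X) (rscale X) (\<lambda>g. g) (rmod X (Suc k)) (rmod X (Suc k))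
      (\<lambda>x. \<sigma> (rbd X (Suc k) x))"
    by (rule controlled_equivariant_compose[OF resolution_left_module resolution_submodule
          resolution_submodule resolution_bd \<sigma>])
  have "controlled (rscale X) (rscale X) (\<lambda>g. g) (rmod X (Suc k)) (rmod X (Suc k)) ?f"
    by (rule controlled_diff[OF resolution_left_module resolution_submodule resolution_submodule f \<sigma>bd])
  moreover have "?f x \<in> cycles X (Suc k)" if x: "x \<in> rmod X (Suc k)" for x
  proof -
    have "rbd X (Suc k) (?f x) = rbd X (Suc k) (f (Suc k) x) - rbd X (Suc k) (\<sigma> (rbd X (Suc k) x))"
      by (rule module_hom_on_minus[OF resolution_left_module resolution_submodule resolution_bd])
        (use controlled_in[OF f x] controlled_in[OF \<sigma>bd x] in auto)
    then show ?thesis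
      using chain[OF x] \<sigma>_bd[OF resolution_bd_cycles[OF x]] controlled_in[OF calculation x]
      by (simp add: cycles_Suc)
  qed
  ultimately have "controlled (rscale X) (rscale X) (\<lambda>g. g) (rmod X (Suc k)) (cycles X (Suc k)) ?f"
    by (rule controlled_mono_codomain)
  from controlled_lifting_cycles[OF resolution_projective resolution_submodule resolution_left_module _ this]
  \<comment> \<open>On cycles the subtracted term is \<open>\<sigma> 0 = 0\<close>, so lifting
    \<open>?f\<close> there lifts \<open>f (Suc k)\<close>.\<close>
  show ?case
    by (auto simp: coarse_map_def cycles_Suc add.assoc[symmetric]
        controlled_zero[OF \<sigma> resolution_submodule])
qed

end

section \<open>Controlled comparison of resolutions over different groups\<close>

lemma gact_trivial_scale: "gact trivial_scale g r = r"
  by (simp add: trivial_scale_def)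

lemma controlled_chain_map:
  fixes X :: "('g::group_add \<Rightarrow>\<^sub>0 'r::ring_1, 'r, 'a::ab_group_add) resolution"
    and Y :: "('h::group_add \<Rightarrow>\<^sub>0 'r, 'r, 'b::ab_group_add) resolution"
  assumes X: "projective_resolution X" and Y: "projective_resolution Y" and \<phi>: "coarse_map \<phi>"
  obtains h where
    "\<And>k. controlled (rscale X) (rscale Y) \<phi> (rmod X k) (rmod Y k) (h k)"
    "\<And>x. x \<in> rmod X 0 \<Longrightarrow> raug Y (h 0 x) = raug X x"
    "\<And>k x. x \<in> rmod X (Suc k) \<Longrightarrow> rbd Y (Suc k) (h (Suc k) x) = h k (rbd X (Suc k) x)"
proof -
  note Xr = resolution_projective[OF X] resolution_submodule[OF X] resolution_left_module[OF X]
  \<comment> \<open>Preservation of cycles is carried along because it puts the composite with the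
    next boundary map into the image of the boundary of \<open>Y\<close>, ready for lifting.\<close>
  define good where "good k h \<longleftrightarrow> controlled (rscale X) (rscale Y) \<phi> (rmod X k) (rmod Y k) h \<and>
    (\<forall>x\<in>cycles X k. h x \<in> cycles Y k) \<and> (k = 0 \<longrightarrow> (\<forall>x\<in>rmod X 0. raug Y (h x) = raug X x))" for k h
  have "\<exists>h. good 0 h"
  proof -
    interpret group_ring_module "rscale Y"
      using resolution_left_module[OF Y] by (simp add: group_ring_module_def)
    \<comment> \<open>Both groups act trivially on the coefficients, so the translated values of the
      augmentation are constant, whatever \<open>\<phi>\<close> is.\<close>
    have "controlled (rscale X) (trivial_scale :: ('h \<Rightarrow>\<^sub>0 'r) \<Rightarrow> _) \<phi> (rmod X 0) UNIV (raug X)"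
      using resolution_aug[OF X]
      by (auto simp: controlled_def module_hom_on_def gact_trivial_scale)
        (simp add: trivial_scale_def)
    from controlled_lifting[OF resolution_left_module[OF Y] _ Xr resolution_submodule[OF Y] this
        resolution_aug[OF Y] resolution_aug_surj[OF Y] \<phi>]
    obtain h where h: "controlled (rscale X) (rscale Y) \<phi> (rmod X 0) (rmod Y 0) h"
      "\<And>x. x \<in> rmod X 0 \<Longrightarrow> raug Y (h x) = raug X x"
      by (auto simp: gact_trivial_scale)
    then have "good 0 h" using controlled_in[OF h(1)] by (auto simp: good_def cycles_def)
    then show ?thesis by blast
  qed
  moreover have "\<exists>h'. good (Suc k) h' \<and>
      (\<forall>x\<in>rmod X (Suc k). rbd Y (Suc k) (h' x) = h (rbd X (Suc k) x))" if h: "good k h" for k h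
  proof -
    have hc: "controlled (rscale X) (rscale Y) \<phi> (rmod X k) (rmod Y k) h"
      using h by (simp add: good_def)
    have "controlled (rscale X) (rscale Y) \<phi> (rmod X (Suc k)) (rmod Y k) (\<lambda>x. h (rbd X (Suc k) x))"
      by (rule controlled_equivariant_compose[OF Xr(3) Xr(2) Xr(2) resolution_bd[OF X] hc])
    then have "controlled (rscale X) (rscale Y) \<phi> (rmod X (Suc k)) (cycles Y k) (\<lambda>x. h (rbd X (Suc k) x))"
      by (rule controlled_mono_codomain) (use h resolution_bd_cycles[OF X] in \<open>auto simp: good_def\<close>)
    from controlled_lifting_cycles[OF Y Xr \<phi> this]
    obtain h' where h': "controlled (rscale X) (rscale Y) \<phi> (rmod X (Suc k)) (rmod Y (Suc k)) h'"
      "\<And>x. x \<in> rmod X (Suc k) \<Longrightarrow> rbd Y (Suc k) (h' x) = h (rbd X (Suc k) x)" by blast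
    have "h' x \<in> cycles Y (Suc k)" if "x \<in> cycles X (Suc k)" for x
      using that h'(2)[of x] controlled_in[OF h'(1)] controlled_zero[OF hc Xr(2)]
      by (auto simp: cycles_Suc)
    with h' show ?thesis by (auto simp: good_def)
  qed
  \<comment> \<open>Dependent choice: each map is selected relative to the one chosen in the degree
    below.\<close>
  ultimately obtain h where "\<And>k. good k (h k)"
    "\<And>k. \<forall>x\<in>rmod X (Suc k). rbd Y (Suc k) (h (Suc k) x) = h k (rbd X (Suc k) x)"
    using dependent_nat_choice[of good "\<lambda>k h h'. \<forall>x\<in>rmod X (Suc k). rbd Y (Suc k) (h' x) = h (rbd X (Suc k) x)"]
    by blast
  then show ?thesis using that[of h] by (auto simp: good_def)
qed

section \<open>Norm estimates\<close>

definition support_sum :: "('c::zero \<Rightarrow> real) \<Rightarrow> ('b \<Rightarrow>\<^sub>0 'c) \<Rightarrow> real" where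
  "support_sum N p = (\<Sum>k\<in>Poly_Mapping.keys p. N (Poly_Mapping.lookup p k))"

lemma l1_norm_conv_support_sum: "l1_norm nrm s B x = support_sum (support_sum nrm) (coords s B x)"
  by (simp add: l1_norm_def support_sum_def Let_def)

lemma support_sum_superset:
  assumes "N 0 = 0" "finite A" "Poly_Mapping.keys p \<subseteq> A"
  shows "support_sum N p = (\<Sum>k\<in>A. N (Poly_Mapping.lookup p k))"
  unfolding support_sum_def using assms
  by (intro sum.mono_neutral_left) (auto simp: in_keys_iff)

lemma support_sum_zero [simp]: "support_sum N 0 = 0"
  by (simp add: support_sum_def)

lemma support_sum_single: "N 0 = 0 \<Longrightarrow> support_sum N (Poly_Mapping.single k c) = N c"
  by (cases "c = 0") (simp_all add: support_sum_def)

lemma support_sum_nonneg: "(\<And>x. 0 \<le> N x) \<Longrightarrow> 0 \<le> support_sum N p"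
  by (simp add: support_sum_def sum_nonneg)

lemma support_sum_add:
  assumes "N 0 = 0" "\<And>x y. N (x + y) \<le> N x + N y"
  shows "support_sum N (p + q) \<le> support_sum N p + support_sum N q"
proof -
  let ?A = "Poly_Mapping.keys p \<union> Poly_Mapping.keys q"
  have "Poly_Mapping.keys (p + q) \<subseteq> ?A"
    by (rule Poly_Mapping.keys_add)
  then show ?thesis
    using assms(2)
    by (simp add: support_sum_superset[where N = N and A = ?A, OF assms(1)] lookup_add sum.distrib[symmetric] sum_mono)
qed

lemma support_sum_free_scale:
  assumes "N 0 = 0" "\<And>x. N (c * x) \<le> K * N x"
  shows "support_sum N (free_scale c p) \<le> K * support_sum N p"
proof -
  have "Poly_Mapping.keys (free_scale c p) \<subseteq> Poly_Mapping.keys p"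
    by (auto simp: in_keys_iff lookup_free_scale)
  then show ?thesis
    using assms(2)
    by (simp add: support_sum_superset[where N = N and A = "Poly_Mapping.keys p", OF assms(1)] lookup_free_scale
        sum_distrib_left sum_mono)
qed

text \<open>Subadditivity is assumed on \<open>M\<close> only, because coordinates, and with them
  the norms, are meaningful only there.\<close>

lemma subadditive_sum:
  fixes L :: "'m::ab_group_add \<Rightarrow> real"
  assumes M: "submodule s M" and "L 0 = 0" "\<And>x y. x \<in> M \<Longrightarrow> y \<in> M \<Longrightarrow> L (x + y) \<le> L x + L y"
    and "\<And>i. i \<in> A \<Longrightarrow> x i \<in> M"
  shows "L (sum x A) \<le> (\<Sum>i\<in>A. L (x i))"
  using assms(4)
proof (induction A rule: infinite_finite_induct)
  case (insert i A)
  then have "sum x A \<in> M" by (intro submodule_sum[OF M]) auto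
  then have "L (x i + sum x A) \<le> L (x i) + L (sum x A)" using insert assms(3) by blast
  then show ?case using insert by fastforce
qed (use assms in auto)

section \<open>Coordinates with respect to a fixed basis\<close>

context
  fixes s :: "'s::ring_1 \<Rightarrow> 'm::ab_group_add \<Rightarrow> 'm" and M B :: "'m set"
  assumes s: "left_module s" "submodule s M" and B: "module_basis s M B"
begin

interpretation left_module s by (rule s)

lemma coords_props:
  assumes "x \<in> M"
  shows "Poly_Mapping.keys (coords s B x) \<subseteq> B" "lincomb s (\<lambda>b. b) (coords s B x) = x"
proof -
  have "\<exists>!\<phi>. Poly_Mapping.keys \<phi> \<subseteq> B \<and> x = lincomb s (\<lambda>b. b) \<phi>"
    using B assms by (simp add: module_basis_def)
  from theI'[OF this] show "Poly_Mapping.keys (coords s B x) \<subseteq> B"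
    "lincomb s (\<lambda>b. b) (coords s B x) = x" by (auto simp: coords_def)
qed

lemma coords_eqI:
  assumes "x \<in> M" "Poly_Mapping.keys \<phi> \<subseteq> B" "lincomb s (\<lambda>b. b) \<phi> = x"
  shows "coords s B x = \<phi>"
  using B assms coords_props[OF assms(1)] unfolding module_basis_def by metis

lemma coords_add:
  assumes "x \<in> M" "y \<in> M" shows "coords s B (x + y) = coords s B x + coords s B y"
  using assms s(2) coords_props[OF assms(1)] coords_props[OF assms(2)]
    Poly_Mapping.keys_add[of "coords s B x" "coords s B y"]
  by (intro coords_eqI) (auto simp: lincomb_add submodule_def)

lemma coords_scale:
  assumes "x \<in> M" shows "coords s B (s a x) = free_scale a (coords s B x)"
proof (rule coords_eqI)
  have "Poly_Mapping.keys (free_scale a (coords s B x)) \<subseteq> Poly_Mapping.keys (coords s B x)"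
    by (auto simp: in_keys_iff lookup_free_scale)
  then show "Poly_Mapping.keys (free_scale a (coords s B x)) \<subseteq> B"
    using coords_props[OF assms] by blast
qed (use assms s(2) coords_props[OF assms] in \<open>auto simp: lincomb_free_scale submodule_def\<close>)

lemma coords_zero: "coords s B 0 = 0"
  using s(2) by (intro coords_eqI) (auto simp: submodule_def lincomb_def)

end

context normed_unital_ring
begin

lemma support_sum_nrm_add: "support_sum nrm (p + q) \<le> support_sum nrm p + support_sum nrm q"
  by (rule support_sum_add) (simp_all add: nrm_eq_0_iff nrm_add)

lemma support_sum_nrm_single_0_times:
  "support_sum nrm (Poly_Mapping.single 0 a * p) \<le> nrm a * support_sum nrm p"
  for p :: "'g::group_add \<Rightarrow>\<^sub>0 'r"
  unfolding single_0_times by (rule support_sum_free_scale) (simp_all add: nrm_eq_0_iff nrm_mult)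

text \<open>Translation merely moves the monomials, so the triangle inequality gives the constant 1.
  Submultiplicativity would cost a factor \<open>nrm 1\<close>, which may exceed 1.\<close>

lemma support_sum_nrm_translate:
  "support_sum nrm (Poly_Mapping.single g 1 * p) \<le> support_sum nrm p"
  for p :: "'g::group_add \<Rightarrow>\<^sub>0 'r"
proof -
  have "Poly_Mapping.single g 1 * p =
      (\<Sum>x\<in>Poly_Mapping.keys p. Poly_Mapping.single (g + x) (Poly_Mapping.lookup p x))"
    by (subst sum_singles[of p]) (simp add: sum_distrib_left mult_single)
  also have "support_sum nrm \<dots> \<le>
      (\<Sum>x\<in>Poly_Mapping.keys p. support_sum nrm (Poly_Mapping.single (g + x) (Poly_Mapping.lookup p x)))"
    by (rule subadditive_sum[of free_scale UNIV]) (auto simp: submodule_def support_sum_nrm_add)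
  also have "\<dots> = support_sum nrm p"
    by (simp add: support_sum_single nrm_eq_0_iff support_sum_def[of nrm p])
  finally show ?thesis .
qed

context
  fixes s :: "('g::group_add \<Rightarrow>\<^sub>0 'r) \<Rightarrow> 'm::ab_group_add \<Rightarrow> 'm" and M B :: "'m set"
  assumes s: "left_module s" "submodule s M" and B: "module_basis s M B"
begin

lemma l1_norm_nonneg: "0 \<le> l1_norm nrm s B x"
  by (simp add: l1_norm_conv_support_sum support_sum_nonneg nrm_nonneg)

lemma l1_norm_zero: "l1_norm nrm s B 0 = 0"
  by (simp add: l1_norm_conv_support_sum coords_zero[OF s B])

lemma l1_norm_add:
  "x \<in> M \<Longrightarrow> y \<in> M \<Longrightarrow> l1_norm nrm s B (x + y) \<le> l1_norm nrm s B x + l1_norm nrm s B y"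
  by (simp add: l1_norm_conv_support_sum coords_add[OF s B] support_sum_add support_sum_nrm_add)

lemma l1_norm_coeff_scale:
  "x \<in> M \<Longrightarrow> l1_norm nrm s B (coeff_scale s a x) \<le> nrm a * l1_norm nrm s B x"
  by (simp add: l1_norm_conv_support_sum coords_scale[OF s B] support_sum_free_scale
      support_sum_nrm_single_0_times)

lemma l1_norm_gact: "x \<in> M \<Longrightarrow> l1_norm nrm s B (gact s g x) \<le> l1_norm nrm s B x"
  using support_sum_free_scale[of "support_sum nrm" "Poly_Mapping.single g 1" 1]
  by (simp add: l1_norm_conv_support_sum coords_scale[OF s B] support_sum_nrm_translate)

lemma l1_norm_rlincomb:
  assumes w: "\<And>b g. b \<in> Poly_Mapping.keys \<Phi> \<Longrightarrow> w b g \<in> M \<and> l1_norm nrm s B (w b g) \<le> K"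
  shows "l1_norm nrm s B (rlincomb s w \<Phi>) \<le> K * support_sum (support_sum nrm) \<Phi>"
proof -
  note sub = subadditive_sum[where L = "l1_norm nrm s B", OF s(2) l1_norm_zero l1_norm_add]
  let ?a = "\<lambda>b g. Poly_Mapping.lookup (Poly_Mapping.lookup \<Phi> b) g"
  have in_M: "coeff_scale s a (w b g) \<in> M" if "b \<in> Poly_Mapping.keys \<Phi>" for a b g
    using w[OF that] s(2) by (simp add: submodule_def)
  have "l1_norm nrm s B (rlincomb s w \<Phi>) \<le> (\<Sum>b\<in>Poly_Mapping.keys \<Phi>.
      l1_norm nrm s B (lincomb (coeff_scale s) (w b) (Poly_Mapping.lookup \<Phi> b)))"
    unfolding rlincomb_def
    by (rule sub) (auto simp: lincomb_def intro!: submodule_sum[OF s(2)] in_M)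
  also have "\<dots> \<le> (\<Sum>b\<in>Poly_Mapping.keys \<Phi>. \<Sum>g\<in>Poly_Mapping.keys (Poly_Mapping.lookup \<Phi> b).
      l1_norm nrm s B (coeff_scale s (?a b g) (w b g)))"
    unfolding lincomb_def by (intro sum_mono sub) (auto intro: in_M)
  also have "\<dots> \<le> (\<Sum>b\<in>Poly_Mapping.keys \<Phi>. \<Sum>g\<in>Poly_Mapping.keys (Poly_Mapping.lookup \<Phi> b).
      nrm (?a b g) * K)"
  proof (intro sum_mono)
    fix b g assume "b \<in> Poly_Mapping.keys \<Phi>"
    then show "l1_norm nrm s B (coeff_scale s (?a b g) (w b g)) \<le> nrm (?a b g) * K"
      using w[of b g] l1_norm_coeff_scale[of "w b g" "?a b g"] nrm_nonneg[of "?a b g"]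
      by (meson mult_left_mono order_trans)
  qed
  finally show ?thesis
    by (simp add: support_sum_def sum_distrib_left mult.commute)
qed

end

text \<open>Up to translation, \<open>h\<close> takes finitely many values on all translates of the
  finite basis. Translation does not increase the norm, so these values are uniformly bounded, and
  the bound extends linearly over the coefficients.\<close>

lemma controlled_bounded:
  assumes s: "left_module s" "submodule s M" and B: "module_basis s M B" "finite B"
    and t: "left_module t" "submodule t N" and D: "module_basis t N D"
    and h: "controlled s t \<phi> M N h"
  shows "\<exists>K\<ge>0. \<forall>x\<in>M. l1_norm nrm t D (h x) \<le> K * l1_norm nrm s B x"
proof -
  interpret S: group_ring_module s using s by (simp add: group_ring_module_def)
  interpret group_ring_module t using t by (simp add: group_ring_module_def)
  let ?L = "l1_norm nrm t D"
  let ?d = "\<lambda>b g. gact t (- \<phi> g) (h (gact s g b))"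
  have BM: "B \<subseteq> M" using B by (simp add: module_basis_def)
  have gM: "gact s g b \<in> M" if "b \<in> B" for b g using BM that s by (auto simp: submodule_def)
  have fin: "finite (\<Union>b\<in>B. range (?d b))"
    using B BM h by (auto simp: controlled_def)
  \<comment> \<open>Inserting 0 makes the maximum meaningful for an empty basis and \<open>K\<close>
    nonnegative.\<close>
  define K where "K = Max (insert 0 (?L ` (\<Union>b\<in>B. range (?d b))))"
  have "0 \<le> K" unfolding K_def by (rule Max_ge) (use fin in auto)
  have bound: "?L (h (gact s g b)) \<le> K" if b: "b \<in> B" for b g
  proof -
    have "?d b g \<in> N"
      using controlled_in[OF h gM[OF b]] t by (auto simp: submodule_def)
    from l1_norm_gact[OF t D this, of "\<phi> g"] have "?L (h (gact s g b)) \<le> ?L (?d b g)"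
      by (simp add: gact_gact scale_one)
    also have "\<dots> \<le> K"
      unfolding K_def by (rule Max_ge) (use fin b in auto)
    finally show ?thesis .
  qed
  have "?L (h x) \<le> K * l1_norm nrm s B x" if x: "x \<in> M" for x
  proof -
    let ?\<Phi> = "coords s B x"
    have keys: "Poly_Mapping.keys ?\<Phi> \<subseteq> B" and "lincomb s (\<lambda>b. b) ?\<Phi> = x"
      using coords_props[OF s B(1) x] by auto
    then have "x = rlincomb s (\<lambda>b g. gact s g b) ?\<Phi>"
      by (simp add: S.lincomb_conv_rlincomb)
    then have "h x = h (rlincomb s (\<lambda>b g. gact s g b) ?\<Phi>)" by simp
    also have "\<dots> = rlincomb t (\<lambda>b g. h (gact s g b)) ?\<Phi>"
      by (rule hom_rlincomb[OF submodule_coeff_scale[OF s(2)] controlled_hom[OF h]])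
        (use gM keys in auto)
    also have "?L \<dots> \<le> K * support_sum (support_sum nrm) ?\<Phi>"
      by (rule l1_norm_rlincomb[OF t D]) (use keys bound gM controlled_in[OF h] in blast)
    finally show ?thesis by (simp add: l1_norm_conv_support_sum[of nrm s])
  qed
  with \<open>0 \<le> K\<close> show ?thesis by blast
qed

end

section \<open>Quasi-isometries are coarse equivalences\<close>

text \<open>There are finitely many words of bounded length over the finite alphabet of generators
  and their inverses.\<close>

lemma finite_word_ball:
  assumes "finite S" "generates S"
  shows "finite {g. real (word_length S g) \<le> r}"
proof (rule finite_subset)
  let ?U = "S \<union> uminus ` S"
  show "{g. real (word_length S g) \<le> r} \<subseteq> sum_list ` {xs. set xs \<subseteq> ?U \<and> length xs \<le> nat \<lfloor>r\<rfloor>}"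
  proof
    fix g assume g: "g \<in> {g. real (word_length S g) \<le> r}"
    have "\<exists>k xs. length xs = k \<and> set xs \<subseteq> ?U \<and> sum_list xs = g"
      using assms(2) by (auto simp: generates_def)
    from LeastI_ex[OF this] obtain xs where "length xs = word_length S g" "set xs \<subseteq> ?U" "sum_list xs = g"
      unfolding word_length_def by blast
    then show "g \<in> sum_list ` {xs. set xs \<subseteq> ?U \<and> length xs \<le> nat \<lfloor>r\<rfloor>}"
      using g by (intro image_eqI[of _ _ xs]) (auto simp: le_nat_iff le_floor_iff)
  qed
  show "finite (sum_list ` {xs. set xs \<subseteq> ?U \<and> length xs \<le> nat \<lfloor>r\<rfloor>})"
    using assms(1) by (intro finite_imageI finite_lists_length_le) auto
qed

lemma quasi_isometric_groups_coarse_equivalence: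
  assumes "quasi_isometric_groups TYPE('g::group_add) TYPE('h::group_add)"
  obtains \<phi> :: "'g::group_add \<Rightarrow> 'h::group_add" and \<psi> :: "'h \<Rightarrow> 'g"
  where "coarse_map \<phi>" "coarse_map \<psi>"
    "finite (range (\<lambda>g. - g + \<psi> (\<phi> g)))" "finite (range (\<lambda>h. - h + \<phi> (\<psi> h)))"
proof -
  from assms obtain S :: "'g set" and T :: "'h set" and \<phi> K A where
    S: "finite S" "generates S" and T: "finite T" "generates T" and K: "K \<ge> 1"
    and lower: "\<And>x y. word_dist S x y / K - A \<le> word_dist T (\<phi> x) (\<phi> y)"
    and upper: "\<And>x y. word_dist T (\<phi> x) (\<phi> y) \<le> K * word_dist S x y + A"
    and dense: "\<And>z. \<exists>x. word_dist T (\<phi> x) z \<le> A"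
    unfolding quasi_isometric_groups_def quasi_isometry_def by metis
  \<comment> \<open>The quasi-inverse picks a point whose image is within \<open>A\<close> of the
    target.\<close>
  from dense obtain \<psi> where \<psi>: "\<And>z. word_dist T (\<phi> (\<psi> z)) z \<le> A" by metis
  have near: "finite (range (\<lambda>h. - \<phi> (\<psi> h) + h))"
    by (rule finite_subset[OF _ finite_word_ball[OF T, of A]]) (use \<psi> in \<open>auto simp: word_dist_def\<close>)
  \<comment> \<open>The lower quasi-isometry bound pulls finiteness of differences back along
    \<open>\<phi>\<close>: finitely many differences are bounded in length, and balls are
    finite.\<close>
  have reflect: "finite ((\<lambda>(x, y). - x + y) ` P)" if "finite ((\<lambda>(x, y). - \<phi> x + \<phi> y) ` P)" for P
  proof -
    let ?F = "(\<lambda>(x, y). - \<phi> x + \<phi> y) ` P"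
    define r where "r = Max ((\<lambda>z. real (word_length T z)) ` ?F)"
    have "real (word_length S (- x + y)) \<le> K * (r + A)" if P: "(x, y) \<in> P" for x y
    proof -
      have "word_dist T (\<phi> x) (\<phi> y) \<le> r"
        unfolding r_def word_dist_def
        by (rule Max_ge) (use P \<open>finite ?F\<close> in \<open>auto intro!: rev_image_eqI[OF P]\<close>)
      with lower[of x y] have "word_dist S x y / K \<le> r + A" by simp
      then show ?thesis using K by (simp add: word_dist_def field_simps)
    qed
    then show ?thesis
      by (intro finite_subset[OF _ finite_word_ball[OF S, of "K * (r + A)"]]) auto
  qed
  \<comment> \<open>By left invariance the distance from \<open>g\<close> to \<open>g + g'\<close>
    is independent of \<open>g\<close>, so the upper bound is uniform.\<close>
  have "finite (range (\<lambda>g. - \<phi> g + \<phi> (g + g')))" for g'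
  proof (rule finite_subset[OF _ finite_word_ball[OF T, of "K * real (word_length S g') + A"]])
    have "word_dist S g (g + g') = real (word_length S g')" for g
      by (simp add: word_dist_def add.assoc[symmetric])
    then have "word_dist T (\<phi> g) (\<phi> (g + g')) \<le> K * real (word_length S g') + A" for g
      using upper[of g "g + g'"] by simp
    then show "range (\<lambda>g. - \<phi> g + \<phi> (g + g')) \<subseteq>
        {h. real (word_length T h) \<le> K * real (word_length S g') + A}"
      by (auto simp: word_dist_def)
  qed
  then have "coarse_map \<phi>" by (simp add: coarse_map_def)
  moreover have "coarse_map \<psi>"
    unfolding coarse_map_def
  proof
    fix h'
    \<comment> \<open>The path from \<open>\<phi> (\<psi> h)\<close> to
      \<open>\<phi> (\<psi> (h + h'))\<close> runs through \<open>h\<close> and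
      \<open>h + h'\<close>; its outer pieces take finitely many values, and \<open>reflect\<close>
      then removes \<open>\<phi>\<close>.\<close>
    let ?u = "\<lambda>h. - \<phi> (\<psi> h) + h"
    have "finite (range (\<lambda>h. ?u (h + h')))"
      by (rule finite_subset[OF _ near]) auto
    with near have "finite (range (\<lambda>h. ?u h + h' + - ?u (h + h')))"
      by (rule finite_range_combine[where F = "\<lambda>x y. x + h' + - y"])
    moreover have "?u h + h' + - ?u (h + h') = - \<phi> (\<psi> h) + \<phi> (\<psi> (h + h'))" for h
      by (simp add: minus_add add.assoc diff_conv_add_uminus del: add_uminus_conv_diff)
    ultimately show "finite (range (\<lambda>h. - \<psi> h + \<psi> (h + h')))"
      using reflect[of "range (\<lambda>h. (\<psi> h, \<psi> (h + h')))"] by (simp add: image_image)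
  qed
  moreover have inv: "finite (range (\<lambda>h. - h + \<phi> (\<psi> h)))"
  proof -
    have "finite (range (\<lambda>h. - (- \<phi> (\<psi> h) + h)))"
      by (rule finite_range_compose[OF near, of uminus])
    then show ?thesis by (simp add: minus_add)
  qed
  moreover have "finite (range (\<lambda>g. - g + \<psi> (\<phi> g)))"
  proof -
    have "finite (range (\<lambda>g. - \<phi> g + \<phi> (\<psi> (\<phi> g))))"
      by (rule finite_subset[OF _ inv]) auto
    then show ?thesis
      using reflect[of "range (\<lambda>g. (g, \<psi> (\<phi> g)))"] by (simp add: image_image)
  qed
  ultimately show ?thesis using that[of \<phi> \<psi>] by blast
qed

section \<open>Comparison of isoperimetric functions\<close>

context normed_unital_ring
begin

text \<open>One direction of the comparison. The estimate is made in \<open>ennreal\<close>, so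
  finiteness is assumed for \<open>Y\<close> alone and the bound for \<open>X\<close> passes through
  \<open>enn2real\<close> afterwards.\<close>

lemma isoperimetric_growth_le:
  fixes X :: "('g::group_add \<Rightarrow>\<^sub>0 'r, 'r, 'a::ab_group_add) resolution"
    and Y :: "('h::group_add \<Rightarrow>\<^sub>0 'r, 'r, 'b::ab_group_add) resolution"
    and \<phi> :: "'g \<Rightarrow> 'h" and \<psi> :: "'h \<Rightarrow> 'g"
  assumes X: "n_admissible n X B B'" and Y: "n_admissible n Y D D'"
    and \<phi>: "coarse_map \<phi>" and \<psi>: "coarse_map \<psi>"
    and close: "finite (range (\<lambda>g. - g + \<psi> (\<phi> g)))"
    and fin: "\<And>l. l \<ge> 0 \<Longrightarrow> isoperimetric nrm n Y D D' l < \<infinity>"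
  shows "growth_le (\<lambda>l. enn2real (isoperimetric nrm n X B B' l))
                   (\<lambda>l. enn2real (isoperimetric nrm n Y D D' l))"
proof -
  have Xres: "projective_resolution X" and B: "module_basis (rscale X) (rmod X n) B" "finite B"
    and B': "module_basis (rscale X) (rmod X (Suc n)) B'" "finite B'"
    using X by (auto simp: n_admissible_def)
  have Yres: "projective_resolution Y" and D: "module_basis (rscale Y) (rmod Y n) D" "finite D"
    and D': "module_basis (rscale Y) (rmod Y (Suc n)) D'" "finite D'"
    using Y by (auto simp: n_admissible_def)
  note Xm = resolution_left_module[OF Xres] resolution_submodule[OF Xres]
  note Ym = resolution_left_module[OF Yres] resolution_submodule[OF Yres]
  obtain h where
    h: "\<And>k. controlled (rscale X) (rscale Y) \<phi> (rmod X k) (rmod Y k) (h k)" and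
    h_aug: "\<And>x. x \<in> rmod X 0 \<Longrightarrow> raug Y (h 0 x) = raug X x" and
    h_bd: "\<And>k x. x \<in> rmod X (Suc k) \<Longrightarrow> rbd Y (Suc k) (h (Suc k) x) = h k (rbd X (Suc k) x)"
    using controlled_chain_map[OF Xres Yres \<phi>] by blast
  obtain h' where
    h': "\<And>k. controlled (rscale Y) (rscale X) \<psi> (rmod Y k) (rmod X k) (h' k)" and
    h'_aug: "\<And>y. y \<in> rmod Y 0 \<Longrightarrow> raug X (h' 0 y) = raug Y y" and
    h'_bd: "\<And>k y. y \<in> rmod Y (Suc k) \<Longrightarrow> rbd X (Suc k) (h' (Suc k) y) = h' k (rbd Y (Suc k) y)"
    using controlled_chain_map[OF Yres Xres \<psi>] by blast
  \<comment> \<open>Closeness of \<open>\<psi> (\<phi> g)\<close> to \<open>g\<close> makes the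
    round trip controlled over the identity; its difference from the identity is a chain map killed
    by the augmentation, hence null-homotopic on cycles.\<close>
  let ?f = "\<lambda>k x. x - h' k (h k x)"
  have h'h: "controlled (rscale X) (rscale X) (\<lambda>g. g) (rmod X k) (rmod X k) (\<lambda>x. h' k (h k x))" for k
    by (rule controlled_close[OF Xm(1) controlled_compose[OF Ym(1) Xm(2) Ym(2) h h'] close])
  have f: "controlled (rscale X) (rscale X) (\<lambda>g. g) (rmod X k) (rmod X k) (?f k)" for k
    by (rule controlled_diff[OF Xm Xm(2) equivariant_controlled[OF Xm(1)] h'h])
      (simp add: module_hom_on_def)
  have f_aug: "raug X (?f 0 x) = 0" if x: "x \<in> rmod X 0" for x
    using module_hom_on_minus[OF Xm resolution_aug[OF Xres] x controlled_in[OF h'h x]]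
      h_aug[OF x] h'_aug[OF controlled_in[OF h x]] by simp
  have f_bd: "rbd X (Suc k) (?f (Suc k) x) = ?f k (rbd X (Suc k) x)" if x: "x \<in> rmod X (Suc k)" for k x
    using module_hom_on_minus[OF Xm resolution_bd[OF Xres] x controlled_in[OF h'h x]]
      h_bd[OF x] h'_bd[OF controlled_in[OF h x]] by simp
  obtain \<sigma> where \<sigma>: "controlled (rscale X) (rscale X) (\<lambda>g. g) (rmod X n) (rmod X (Suc n)) \<sigma>"
    and \<sigma>_bd: "\<And>x. x \<in> cycles X n \<Longrightarrow> rbd X (Suc n) (\<sigma> x) = x - h' n (h n x)"
    using controlled_null_homotopy[OF Xres f f_aug f_bd] by blast
  let ?LB = "l1_norm nrm (rscale X) B" and ?LB' = "l1_norm nrm (rscale X) B'"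
  let ?LD = "l1_norm nrm (rscale Y) D" and ?LD' = "l1_norm nrm (rscale Y) D'"
  obtain K1 where K1: "K1 \<ge> 0" "\<And>x. x \<in> rmod X n \<Longrightarrow> ?LD (h n x) \<le> K1 * ?LB x"
    using controlled_bounded[OF Xm B Ym D(1) h] by blast
  obtain K2 where K2: "K2 \<ge> 0" "\<And>y. y \<in> rmod Y (Suc n) \<Longrightarrow> ?LB' (h' (Suc n) y) \<le> K2 * ?LD' y"
    using controlled_bounded[OF Ym D' Xm B'(1) h'] by blast
  obtain K3 where K3: "K3 \<ge> 0" "\<And>x. x \<in> rmod X n \<Longrightarrow> ?LB' (\<sigma> x) \<le> K3 * ?LB x"
    using controlled_bounded[OF Xm B Xm B'(1) \<sigma>] by blast
  \<comment> \<open>A single constant dominating all three bounds; the summand 1 keeps it positive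
    for the later division.\<close>
  define C where "C = K1 + K2 + K3 + 1"
  have C: "C > 0" "K1 \<le> C" "K2 < C" "K3 \<le> C" using K1(1) K2(1) K3(1) by (auto simp: C_def)
  let ?FX = "filling_norm nrm n X B'" and ?FY = "filling_norm nrm n Y D'"
  let ?IY = "isoperimetric nrm n Y D D'"
  have "isoperimetric nrm n X B B' l \<le> ennreal (C * enn2real (?IY (C * l + C)) + C * l + C)"
    if l: "l \<ge> 0" for l
    unfolding isoperimetric_def[of nrm n X]
  proof (rule SUP_least, rule ennreal_leI)
    fix b assume "b \<in> {b \<in> rbd X (n + 1) ` rmod X (n + 1). ?LB b \<le> l}"
    then obtain c where c: "c \<in> rmod X (Suc n)" "b = rbd X (Suc n) c" and bl: "?LB b \<le> l" by auto
    have b: "b \<in> cycles X n" "b \<in> rmod X n"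
      using resolution_bd_cycles[OF Xres c(1)] c(2) by (auto simp: cycles_def)
    have hb: "h n b = rbd Y (Suc n) (h (Suc n) c)" using h_bd[OF c(1)] c(2) by simp
    let ?fill = "{?LD' e |e. e \<in> rmod Y (n + 1) \<and> rbd Y (n + 1) e = h n b}"
    \<comment> \<open>The image of \<open>c\<close> fills \<open>h n b\<close>, so the infimum below
      is over a nonempty set.\<close>
    have ne: "?fill \<noteq> {}" using hb controlled_in[OF h c(1)] by auto
    have "?FX b \<le> C * ?LD' e + K3 * ?LB b" if e: "e \<in> rmod Y (Suc n)" "rbd Y (Suc n) e = h n b" for e
    proof -
      \<comment> \<open>Its boundary is
        \<open>h' n (h n b) + (b - h' n (h n b)) = b\<close>.\<close>
      let ?c = "h' (Suc n) e + \<sigma> b"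
      have in_X: "h' (Suc n) e \<in> rmod X (Suc n)" "\<sigma> b \<in> rmod X (Suc n)"
        using controlled_in[OF h' e(1)] controlled_in[OF \<sigma> b(2)] by auto
      then have "?c \<in> rmod X (Suc n)" using Xm(2)[of "Suc n"] by (auto simp: submodule_def)
      moreover have "rbd X (Suc n) ?c = b"
        using resolution_bd[OF Xres, of n] in_X h'_bd[OF e(1)] e(2) \<sigma>_bd[OF b(1)]
        by (simp add: module_hom_on_def)
      ultimately have "?FX b \<le> ?LB' ?c"
        unfolding filling_norm_def
        by (intro cInf_lower bdd_belowI[of _ 0]) (auto simp: l1_norm_nonneg[OF Xm B'(1)])
      also have "\<dots> \<le> ?LB' (h' (Suc n) e) + ?LB' (\<sigma> b)"
        by (rule l1_norm_add[OF Xm B'(1) in_X])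
      also have "\<dots> \<le> K2 * ?LD' e + K3 * ?LB b"
        using K2(2)[OF e(1)] K3(2)[OF b(2)] by simp
      also have "\<dots> \<le> C * ?LD' e + K3 * ?LB b"
        using C(3) l1_norm_nonneg[OF Ym D'(1), of e] by (simp add: mult_right_mono)
      finally show ?thesis .
    qed
    \<comment> \<open>The estimate holds for every filling \<open>e\<close>; solving it for the norm
      of \<open>e\<close> gives a lower bound that passes to the infimum.\<close>
    then have "(?FX b - K3 * ?LB b) / C \<le> ?FY (h n b)"
      unfolding filling_norm_def[of nrm n Y] using C(1)
      by (intro cInf_greatest[OF ne]) (auto simp: field_simps)
    then have "?FX b \<le> C * ?FY (h n b) + K3 * ?LB b" using C(1) by (simp add: field_simps)
    moreover have "K3 * ?LB b \<le> C * l"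
      using C(1,4) bl l1_norm_nonneg[OF Xm B(1), of b] by (intro mult_mono) auto
    moreover have "?FY (h n b) \<le> enn2real (?IY (C * l + C))"
    proof -
      have "?LD (h n b) \<le> K1 * ?LB b" by (rule K1(2)[OF b(2)])
      also have "\<dots> \<le> C * l"
        using C(1,2) bl l1_norm_nonneg[OF Xm B(1), of b] by (intro mult_mono) auto
      also have "\<dots> \<le> C * l + C" using C(1) by simp
      finally have "ennreal (?FY (h n b)) \<le> ?IY (C * l + C)"
        unfolding isoperimetric_def using hb controlled_in[OF h c(1)]
        by (intro SUP_upper) auto
      \<comment> \<open>Since \<open>enn2real\<close> sends infinity to 0, its monotonicity needs a
        finite upper value.\<close>
      moreover have "?IY (C * l + C) < \<infinity>" using fin C(1) l by simp
      moreover have "0 \<le> ?FY (h n b)"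
        unfolding filling_norm_def
        by (intro cInf_greatest[OF ne]) (auto simp: l1_norm_nonneg[OF Ym D'(1)])
      ultimately show ?thesis
        using enn2real_mono[of "ennreal (?FY (h n b))" "?IY (C * l + C)"] by simp
    qed
    then have "C * ?FY (h n b) \<le> C * enn2real (?IY (C * l + C))" using C(1) by simp
    ultimately show "?FX b \<le> C * enn2real (?IY (C * l + C)) + C * l + C" using C(1) by linarith
  qed
  moreover have "0 \<le> C * enn2real (?IY (C * l + C)) + C * l + C" if "l \<ge> 0" for l
    using C(1) that by simp
  ultimately show ?thesis
    unfolding growth_le_def using C(1) by (intro exI[of _ C]) (auto intro: enn2real_leI)
qed

end

theorem corollary1p6:
  fixes nrm :: "'r::ring_1 \<Rightarrow> real"
    and n :: nat
    and X :: "('g::group_add \<Rightarrow>\<^sub>0 'r, 'r, 'a::ab_group_add) resolution" and B B' :: "'a set"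
    and Y :: "('h::group_add \<Rightarrow>\<^sub>0 'r, 'r, 'b::ab_group_add) resolution" and D D' :: "'b set"
  assumes "rational_normed_ring nrm"
    and "quasi_isometric_groups TYPE('g) TYPE('h)"
    and "\<exists>U :: ('g \<Rightarrow>\<^sub>0 'r, 'r, 'c::ab_group_add) resolution. dim_admissible n U"
    and "\<exists>V :: ('h \<Rightarrow>\<^sub>0 'r, 'r, 'd::ab_group_add) resolution. dim_admissible n V"
    and "n_admissible n X B B'"
    and "n_admissible n Y D D'"
    and "\<forall>l\<ge>0. isoperimetric nrm n X B B' l < \<infinity>"
    and "\<forall>l\<ge>0. isoperimetric nrm n Y D D' l < \<infinity>"
  shows "same_growth_class
           (\<lambda>l. enn2real (isoperimetric nrm n X B B' l))
           (\<lambda>l. enn2real (isoperimetric nrm n Y D D' l))"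
proof -
  interpret rational_normed_ring nrm by fact
  obtain \<phi> :: "'g \<Rightarrow> 'h" and \<psi> :: "'h \<Rightarrow> 'g"
    where "coarse_map \<phi>" "coarse_map \<psi>"
      "finite (range (\<lambda>g. - g + \<psi> (\<phi> g)))" "finite (range (\<lambda>h. - h + \<phi> (\<psi> h)))"
    using quasi_isometric_groups_coarse_equivalence[OF assms(2)] by blast
  \<comment> \<open>The reverse estimate exchanges the groups and the two coarse maps; each
    closeness condition serves one direction.\<close>
  then show ?thesis
    unfolding same_growth_class_def using assms(5-8)
    by (intro conjI isoperimetric_growth_le[of n X B B' Y D D' \<phi> \<psi>]
        isoperimetric_growth_le[of n Y D D' X B B' \<psi> \<phi>]) auto
qed

end
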